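(* Let $h\in k_\infty\setminus k$ be quadratic over $k$. Then the set $j^{\rm qt}(h)\subset k_\infty\cup\{\infty\}$ is finite, i.e. $\# j^{\rm qt}(h)<\infty$.
   Context: $\mathbb{F}_q$ is the field with $q=p^r$ elements, $A=\mathbb{F}_q[T]$, $k=\mathbb{F}_q(T)$, and $k_\infty=\mathbb{F}_q((1/T))$ is the completion of $k$ for the valuation $v=-\deg_T$, with absolute value $|x|=q^{-v(x)}$. For $x\in k_\infty$, $\|x\|=\min_{\alpha\in A}|x-\alpha|$ is the distance from $x$ to the nearest element of $A$. For $h\in k_\infty$ and real $\varepsilon>0$ put $\Lambda_\varepsilon(h)=\{\lambda\in A:\ \|\lambda h\|<\varepsilon\}$ and let $\Lambda^{\rm mon}_\varepsilon(h)$ be the set of monic polynomials in $\Lambda_\varepsilon(h)$. For integers $n\ge 1$ let $\zeta_{h,\varepsilon}(n)=\sum_{\lambda\in\Lambda^{\rm mon}_\varepsilon(h)}\lambda^{-n}\in k_\infty$, and let $$\tilde J_\varepsilon(h)=\frac{\zeta_{h,\varepsilon}(q^2-1)}{\zeta_{h,\varepsilon}(q-1)^{q+1}},\quad J_\varepsilon(h)=\frac{T^{q^2}-T}{(T^q-T)^{q+1}}\,\tilde J_\varepsilon(h),\quad j_\varepsilon(h)=\frac{1}{\frac{1}{T^q-T}-J_\varepsilon(h)}\in k_\infty\cup\{\infty\}$$ (with $1/0=\infty$). $j^{\rm qt}(h)\subset k_\infty\cup\{\infty\}$ is the set of all limits of $j_\varepsilon(h)$ as $\varepsilon\to 0$,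 i.e. the set of all limits of convergent sequences $j_{\varepsilon_i}(h)$ with $\varepsilon_i\to 0$ (convergence to $\infty$ meaning that absolute values tend to infinity). *)

theory Defs
  imports "HOL-Analysis.Analysis" "HOL-Computational_Algebra.Computational_Algebra"
begin

text \<open>
  The finite field is a type \<open>'a\<close> of sort \<open>{field, finite}\<close>, with \<open>q = CARD('a)\<close>, and
  \<open>A\<close> is the type \<open>'a poly\<close>. The field \<open>k\<^sub>\<infinity>\<close> of Laurent series in \<open>1/T\<close> is the type
  \<open>'a fls\<close>: its formal variable \<open>fls_X\<close> stands for \<open>1/T\<close>, so that \<open>T\<close> is \<open>fls_X_inv\<close>
  and the valuation \<open>v = - deg\<^sub>T\<close> is \<open>fls_subdegree\<close>.
\<close>

definition T_inf :: "'a::{field,finite} fls" where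
  "T_inf = fls_X_inv"

definition A_to_kinf :: "'a::{field,finite} poly \<Rightarrow> 'a fls" where
  "A_to_kinf a = poly (map_poly fls_const a) T_inf"

definition ratfuns :: "'a::{field,finite} fls set" where
  "ratfuns = {A_to_kinf a / A_to_kinf b | a b. b \<noteq> 0}"

text \<open>
  The library metric on \<open>'a fls\<close> is \<open>2\<close> to the power \<open>- v (x - y)\<close>. It induces the same
  topology as the absolute value below, so library limits and sums can be used.
\<close>

definition abs_inf :: "'a::{field,finite} fls \<Rightarrow> real" where
  "abs_inf x = (if x = 0 then 0 else real CARD('a) powi (- fls_subdegree x))"

text \<open>The infimum is attained, namely at the polynomial part (in \<open>T\<close>) of \<open>x\<close>.\<close>

definition dist_A :: "'a::{field,finite} fls \<Rightarrow> real" where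
  "dist_A x = (INF \<alpha>. abs_inf (x - A_to_kinf \<alpha>))"

definition Lam :: "real \<Rightarrow> 'a::{field,finite} fls \<Rightarrow> 'a poly set" where
  "Lam \<epsilon> h = {a. dist_A (A_to_kinf a * h) < \<epsilon>}"

definition Lam_mon :: "real \<Rightarrow> 'a::{field,finite} fls \<Rightarrow> 'a poly set" where
  "Lam_mon \<epsilon> h = {a \<in> Lam \<epsilon> h. lead_coeff a = 1}"

text \<open>
  For \<open>n \<ge> 1\<close> the family is always summable, since only finitely many polynomials have a
  given degree; the default value of \<open>infsum\<close> plays no role.
\<close>

definition zeta_qt :: "real \<Rightarrow> 'a::{field,finite} fls \<Rightarrow> nat \<Rightarrow> 'a fls" where
  "zeta_qt \<epsilon> h n = (\<Sum>\<^sub>\<infinity>a\<in>Lam_mon \<epsilon> h. inverse (A_to_kinf a) ^ n)"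

text \<open>
  For \<open>\<epsilon> > 0\<close> and \<open>n \<ge> 1\<close> the value \<open>zeta_qt \<epsilon> h n\<close> is never \<open>0\<close>: \<open>Lam \<epsilon> h\<close> is a
  nonzero additive group closed under multiplication by constants, so it has exactly one monic
  element of least degree, which gives the dominant term of the sum. All quotients in the next two
  definitions are therefore genuine.
\<close>

definition J_tilde :: "real \<Rightarrow> 'a::{field,finite} fls \<Rightarrow> 'a fls" where
  "J_tilde \<epsilon> h =
     zeta_qt \<epsilon> h (CARD('a)^2 - 1) / zeta_qt \<epsilon> h (CARD('a) - 1) ^ (CARD('a) + 1)"

definition J_eps :: "real \<Rightarrow> 'a::{field,finite} fls \<Rightarrow> 'a fls" where
  "J_eps \<epsilon> h =
     (T_inf ^ (CARD('a)^2) - T_inf) / (T_inf ^ CARD('a) - T_inf) ^ (CARD('a) + 1) * J_tilde \<epsilon> h"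

text \<open>
  \<open>k\<^sub>\<infinity> \<union> {\<infinity>}\<close> is the type \<open>'a fls option\<close>, with \<open>None\<close> as the point \<open>\<infinity>\<close>.
\<close>

definition recip :: "'a::{field,finite} fls \<Rightarrow> 'a fls option" where
  "recip x = (if x = 0 then None else Some (1 / x))"

definition j_eps :: "real \<Rightarrow> 'a::{field,finite} fls \<Rightarrow> 'a fls option" where
  "j_eps \<epsilon> h = recip (1 / (T_inf ^ CARD('a) - T_inf) - J_eps \<epsilon> h)"

definition converges_to :: "(nat \<Rightarrow> 'a::{field,finite} fls option) \<Rightarrow> 'a fls option \<Rightarrow> bool" where
  "converges_to s L = (case L of
       Some x \<Rightarrow> (\<exists>y. (\<forall>\<^sub>F i in sequentially. s i = Some (y i)) \<and> y \<longlonglongrightarrow> x)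
     | None \<Rightarrow> (\<forall>B::real. \<forall>\<^sub>F i in sequentially. \<forall>y. s i = Some y \<longrightarrow> abs_inf y > B))"

definition j_qt :: "'a::{field,finite} fls \<Rightarrow> 'a fls option set" where
  "j_qt h = {L. \<exists>\<epsilon> :: nat \<Rightarrow> real.
     (\<forall>i. \<epsilon> i > 0) \<and> \<epsilon> \<longlonglongrightarrow> 0 \<and> converges_to (\<lambda>i. j_eps (\<epsilon> i) h) L}"

text \<open>For a subfield \<open>K\<close>: the minimal polynomial of \<open>x\<close> over \<open>K\<close> has degree \<open>2\<close>.\<close>

definition quadratic_over :: "'b::field set \<Rightarrow> 'b \<Rightarrow> bool" where
  "quadratic_over K x \<longleftrightarrow>
     (\<exists>P. degree P = 2 \<and> (\<forall>i. coeff P i \<in> K) \<and> poly P x = 0) \<and>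
     \<not> (\<exists>P. P \<noteq> 0 \<and> degree P < 2 \<and> (\<forall>i. coeff P i \<in> K) \<and> poly P x = 0)"

end

theory Submission
  imports Defs
begin

text \<open>
  Let \<open>h'\<close> be the conjugate of \<open>h\<close> over \<open>k\<close> and \<open>a\<close> the leading coefficient of an equation
  \<open>a h\<^sup>2 + b h + c = 0\<close> over \<open>A\<close>. A pair \<open>(\<lambda>, \<mu>)\<close> of polynomials has the two images
  \<open>x = \<lambda> h - \<mu>\<close> and \<open>x' = \<lambda> h' - \<mu>\<close>; the condition \<open>\<parallel>\<lambda> h\<parallel> < \<epsilon>\<close> says that \<open>x\<close> is small for
  some \<open>\<mu>\<close>, and \<open>\<lambda> (h - h') = x - x'\<close>. The order \<open>A[a h]\<close> acts on the pairs and multiplies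
  \<open>x\<close> and \<open>x'\<close> by conjugate numbers.

  A pigeonhole argument of Pell type (\<open>pell_unit\<close>) gives \<open>\<eta>\<close> in this order with
  \<open>\<eta> \<eta>' = 1\<close>, \<open>|\<eta>| = q\<^bsup>-m\<^esup> < 1\<close> and \<open>\<eta>'\<close> of leading coefficient \<open>1\<close>. Write \<open>approx N\<close> for the pairs with
  \<open>\<lambda>\<close> monic and \<open>|x| \<le> q\<^bsup>-N\<^esup>\<close>. For large \<open>N\<close> the norm form forces \<open>|x'| > 1 > |x|\<close>, so the
  leading coefficient of \<open>\<lambda>\<close> can be read off from \<open>x'\<close>; hence \<open>\<eta>\<^sup>l\<close> maps \<open>approx N\<close>
  bijectively onto \<open>approx (N + l m)\<close> (\<open>bij_betw_act_funpow\<close>). After the substitution,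
  \<open>\<lambda> = (\<eta>\<^sup>l x - \<eta>'\<^sup>l x') / (h - h')\<close>, so the sum \<open>\<zeta>(n)\<close> at scale \<open>N + l m\<close> is a scalar to the
  power \<open>n\<close> times
  \<open>\<Sum> (x' - \<theta>\<^sup>l x)\<^bsup>-n\<^esup>\<close> over the fixed index set \<open>approx N\<close>, where \<open>\<theta> = \<eta> / \<eta>'\<close> and \<open>|\<theta>| < 1\<close>
  (\<open>zeta_approx_shift\<close>).

  The quotient \<open>\<zeta>(q\<^sup>2 - 1) / \<zeta>(q - 1)\<^bsup>q+1\<^esup>\<close> is homogeneous of degree \<open>0\<close>, so the scalars cancel.
  The remaining sums converge to \<open>\<Sum> x'\<^bsup>-n\<^esup>\<close> as \<open>l \<rightarrow> \<infinity>\<close> (\<open>perturbed_tendsto\<close>), and this limit is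
  not \<open>0\<close> since a unique monic \<open>\<lambda>\<close> of least degree gives its dominant term (\<open>zeta_conj_neq_0\<close>).
  So the values of \<open>j\<close> converge along each residue class of scales modulo \<open>m\<close>, and \<open>j_qt h\<close> has
  at most \<open>m\<close> elements (\<open>j_qt_subset\<close>).
\<close>

unbundle fps_syntax

section \<open>Topology and summation in the field of Laurent series\<close>

text \<open>
  The closed ball \<open>|x| \<le> q\<^bsup>-m\<^esup>\<close>. Unlike a bound on \<open>fls_subdegree\<close>, whose value at \<open>0\<close> is \<open>0\<close>,
  this contains \<open>0\<close> for every \<open>m\<close>, so the balls are additive groups without case distinctions.
\<close>

definition ord_ge :: "int \<Rightarrow> 'a::zero fls \<Rightarrow> bool" where
  "ord_ge m x \<longleftrightarrow> (\<forall>k<m. x $$ k = 0)"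

lemma ord_ge_iff: "ord_ge m x \<longleftrightarrow> x = 0 \<or> fls_subdegree x \<ge> m"
  unfolding ord_ge_def by (metis fls_eq0_below_subdegree fls_subdegree_geI fls_zero_nth order_less_le_trans)

lemma ord_ge_0 [simp]: "ord_ge m 0"
  by (simp add: ord_ge_def)

lemma ord_ge_add: "ord_ge m x \<Longrightarrow> ord_ge m y \<Longrightarrow> ord_ge m (x + y)"
  for x :: "'a::monoid_add fls"
  by (simp add: ord_ge_def)

lemma ord_ge_diff: "ord_ge m x \<Longrightarrow> ord_ge m y \<Longrightarrow> ord_ge m (x - y)"
  for x :: "'a::group_add fls"
  by (simp add: ord_ge_def)

lemma ord_ge_diff_commute: "ord_ge m (x - y) \<longleftrightarrow> ord_ge m (y - x)"
  for x :: "'a::ab_group_add fls"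
  by (auto simp: ord_ge_def)

lemma ord_ge_mono: "ord_ge m x \<Longrightarrow> n \<le> m \<Longrightarrow> ord_ge n x"
  by (auto simp: ord_ge_def)

lemma ord_ge_sum: "(\<And>i. i \<in> F \<Longrightarrow> ord_ge m (f i)) \<Longrightarrow> ord_ge m (sum f F)"
  for f :: "'b \<Rightarrow> 'a::comm_monoid_add fls"
  by (simp add: ord_ge_def fls_nth_sum)

lemma ord_ge_mult: "ord_ge m x \<Longrightarrow> ord_ge n y \<Longrightarrow> ord_ge (m + n) (x * y)"
  for x :: "'a::field fls"
  by (cases "x = 0 \<or> y = 0") (auto simp: ord_ge_iff)

lemma ord_ge_power: "ord_ge m x \<Longrightarrow> ord_ge (int n * m) (x ^ n)"
  for x :: "'a::field fls"
  by (cases "n = 0") (auto simp: ord_ge_iff fls_subdegree_pow zero_power mult_left_mono)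

lemma subdegree_inverse: "fls_subdegree (inverse x) = - fls_subdegree x"
  for x :: "'a::field fls"
  using fls_subdegree_power_int[of x "-1"] by (simp add: power_int_minus)

lemma subdegree_divide: "x \<noteq> 0 \<Longrightarrow> y \<noteq> 0 \<Longrightarrow> fls_subdegree (x / y) = fls_subdegree x - fls_subdegree y"
  for x :: "'a::field fls"
  by (simp add: divide_inverse subdegree_inverse)

lemma dist_fls_le: "ord_ge (int n) (x - y) \<Longrightarrow> dist x y \<le> (1/2) ^ n"
  by (auto simp: ord_ge_iff dist_fls_def power_one_over divide_simps intro!: power_increasing)

lemma ord_ge_if_dist_less: "dist x y < (1/2) ^ n \<Longrightarrow> ord_ge (int n) (x - y)"
proof (rule ccontr)
  assume d: "dist x y < (1/2) ^ n" and "\<not> ord_ge (int n) (x - y)"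
  then have xy: "x \<noteq> y" "fls_subdegree (x - y) < int n" by (auto simp: ord_ge_iff)
  show False
  proof (cases "fls_subdegree (x - y) \<ge> 0")
    case True
    then have "(2::real) ^ nat (fls_subdegree (x - y)) \<le> 2 ^ n"
      using xy by (intro power_increasing) auto
    then show False using d xy True by (simp add: dist_fls_def power_one_over field_simps)
  next
    case False
    have "(1/2::real) ^ n \<le> 1" by (simp add: power_le_one)
    also have "\<dots> \<le> 2 ^ nat (- fls_subdegree (x - y))" by simp
    finally show False using d xy False by (simp add: dist_fls_def)
  qed
qed

text \<open>
  The metric is \<open>2\<close> to the power minus the valuation, so the balls above form a neighbourhood
  basis. All limits below are computed with this criterion.
\<close>

lemma tendsto_fls_iff:
  "(f \<longlongrightarrow> x) F \<longleftrightarrow> (\<forall>m. \<forall>\<^sub>F i in F. ord_ge m (f i - x))"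
proof
  assume f: "(f \<longlongrightarrow> x) F"
  show "\<forall>m. \<forall>\<^sub>F i in F. ord_ge m (f i - x)"
  proof
    fix m
    have "\<forall>\<^sub>F i in F. dist (f i) x < (1/2) ^ nat m"
      using f by (rule tendstoD) simp
    then show "\<forall>\<^sub>F i in F. ord_ge m (f i - x)"
      by eventually_elim (auto dest!: ord_ge_if_dist_less elim: ord_ge_mono)
  qed
next
  assume f: "\<forall>m. \<forall>\<^sub>F i in F. ord_ge m (f i - x)"
  show "(f \<longlongrightarrow> x) F"
  proof (rule tendstoI)
    fix e :: real assume "e > 0"
    then obtain n where n: "(1/2) ^ n < e" using real_arch_pow_inv[of e "1/2"] by auto
    from f have "\<forall>\<^sub>F i in F. ord_ge (int n) (f i - x)" by blast
    then show "\<forall>\<^sub>F i in F. dist (f i) x < e"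
      by eventually_elim (use n dist_fls_le in force)
  qed
qed

instance fls :: (ab_group_add) topological_ab_group_add
proof
  fix a b :: "'a fls"
  show "((\<lambda>x. fst x + snd x) \<longlongrightarrow> a + b) (nhds a \<times>\<^sub>F nhds b)"
    unfolding tendsto_fls_iff
  proof
    fix m
    have "\<forall>\<^sub>F x in nhds a. ord_ge m (x - a)" "\<forall>\<^sub>F x in nhds b. ord_ge m (x - b)"
      using filterlim_ident[of "nhds a"] filterlim_ident[of "nhds b"] by (auto simp: tendsto_fls_iff)
    then have "\<forall>\<^sub>F x in nhds a \<times>\<^sub>F nhds b. ord_ge m (fst x - a) \<and> ord_ge m (snd x - b)"
      by (auto simp: eventually_prod_filter)
    then show "\<forall>\<^sub>F x in nhds a \<times>\<^sub>F nhds b. ord_ge m (fst x + snd x - (a + b))"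
      by eventually_elim (simp add: ord_ge_def)
  qed
  show "(uminus \<longlongrightarrow> - a) (nhds a)"
    unfolding tendsto_fls_iff
  proof
    fix m
    have "\<forall>\<^sub>F x in nhds a. ord_ge m (x - a)"
      using filterlim_ident[of "nhds a"] by (auto simp: tendsto_fls_iff)
    then show "\<forall>\<^sub>F x in nhds a. ord_ge m (- x - - a)"
      by eventually_elim (simp add: ord_ge_def)
  qed
qed

instance fls :: (field) topological_semigroup_mult
proof
  fix a b :: "'a fls"
  show "((\<lambda>x. fst x * snd x) \<longlongrightarrow> a * b) (nhds a \<times>\<^sub>F nhds b)"
    unfolding tendsto_fls_iff
  proof
    fix m
    \<comment> \<open>\<open>- c\<close> is a lower bound for both valuations, and \<open>k\<close> makes each part of the decomposition
      \<open>xy - ab = (x - a) (y - b) + a (y - b) + (x - a) b\<close> small.\<close>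
    define c where "c = max 0 (max \<bar>fls_subdegree a\<bar> \<bar>fls_subdegree b\<bar>)"
    define k where "k = max c (m + c)"
    have ab: "ord_ge (-c) a" "ord_ge (-c) b" by (auto simp: ord_ge_iff c_def)
    have k: "k \<ge> 0" "k \<ge> m" "k \<ge> m + c" "k + k \<ge> m" unfolding k_def c_def by linarith+
    have "\<forall>\<^sub>F x in nhds a. ord_ge k (x - a)" "\<forall>\<^sub>F x in nhds b. ord_ge k (x - b)"
      using filterlim_ident[of "nhds a"] filterlim_ident[of "nhds b"] by (auto simp: tendsto_fls_iff)
    then have "\<forall>\<^sub>F x in nhds a \<times>\<^sub>F nhds b. ord_ge k (fst x - a) \<and> ord_ge k (snd x - b)"
      by (auto simp: eventually_prod_filter)
    then show "\<forall>\<^sub>F x in nhds a \<times>\<^sub>F nhds b. ord_ge m (fst x * snd x - a * b)"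
    proof eventually_elim
      case (elim x)
      have eq: "fst x * snd x - a * b
          = (fst x - a) * (snd x - b) + (a * (snd x - b) + (fst x - a) * b)"
        by (simp add: algebra_simps)
      have "ord_ge (k + k) ((fst x - a) * (snd x - b))" "ord_ge (-c + k) (a * (snd x - b))"
           "ord_ge (k + -c) ((fst x - a) * b)"
        using elim ab ord_ge_mult by blast+
      then show ?case unfolding eq
        using k by (intro ord_ge_add) (auto elim!: ord_ge_mono)
    qed
  qed
qed

text \<open>
  Close to \<open>x \<noteq> 0\<close> the valuation is constant, so \<open>1/y - 1/x = (x - y) / (x y)\<close> is small together
  with \<open>x - y\<close>.
\<close>

lemma tendsto_inverse_fls:
  fixes x :: "'a::field fls"
  assumes f: "(f \<longlongrightarrow> x) F" and x: "x \<noteq> 0"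
  shows "((\<lambda>i. inverse (f i)) \<longlongrightarrow> inverse x) F"
  unfolding tendsto_fls_iff
proof
  fix m
  define s where "s = fls_subdegree x"
  define k where "k = max (s + 1) (m + 2 * s)"
  have "\<forall>\<^sub>F i in F. ord_ge k (f i - x)" using f by (simp add: tendsto_fls_iff)
  then show "\<forall>\<^sub>F i in F. ord_ge m (inverse (f i) - inverse x)"
  proof eventually_elim
    case (elim i)
    have "f i = x \<or> fls_subdegree (x + (f i - x)) = s"
      using elim x fls_subdegree_add_eq1[of x "f i - x"] unfolding s_def
      by (auto simp: ord_ge_iff k_def s_def)
    then have s: "fls_subdegree (f i) = s" by (auto simp: s_def)
    have "f i \<noteq> 0"
    proof
      assume "f i = 0"
      then show False using elim x by (auto simp: ord_ge_iff k_def s_def)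
    qed
    then have "inverse (f i) - inverse x = (x - f i) * (inverse (f i) * inverse x)"
      using x by (simp add: field_simps)
    moreover have "ord_ge (-s + -s) (inverse (f i) * inverse x)"
      by (intro ord_ge_mult) (auto simp: ord_ge_iff subdegree_inverse s s_def)
    ultimately have "ord_ge (k + (-s + -s)) (inverse (f i) - inverse x)"
      using elim ord_ge_diff_commute ord_ge_mult by metis
    then show ?case by (rule ord_ge_mono) (auto simp: k_def)
  qed
qed

lemma tendsto_divide_fls:
  fixes x :: "'a::field fls"
  assumes "(f \<longlongrightarrow> x) F" "(g \<longlongrightarrow> y) F" "y \<noteq> 0"
  shows "((\<lambda>i. f i / g i) \<longlongrightarrow> x / y) F"
  unfolding divide_inverse by (intro tendsto_mult assms tendsto_inverse_fls)

lemma tendsto_power_fls: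
  fixes x :: "'a::field fls"
  assumes "(f \<longlongrightarrow> x) F"
  shows "((\<lambda>i. f i ^ n) \<longlongrightarrow> x ^ n) F"
  by (induction n) (auto intro!: tendsto_mult assms)

lemma ord_ge_has_sum:
  fixes f :: "'b \<Rightarrow> 'a::field fls"
  assumes "(f has_sum s) I" "\<And>i. i \<in> I \<Longrightarrow> ord_ge m (f i)"
  shows "ord_ge m s"
proof -
  have "\<forall>\<^sub>F F in finite_subsets_at_top I. ord_ge m (sum f F - s)"
    using assms(1) by (simp add: has_sum_def tendsto_fls_iff)
  then obtain F where F: "finite F" "F \<subseteq> I" "ord_ge m (sum f F - s)"
    by (auto simp: eventually_finite_subsets_at_top)
  have "ord_ge m (sum f F)" using F assms(2) by (intro ord_ge_sum) auto
  then have "ord_ge m (sum f F - (sum f F - s))" using F(3) by (rule ord_ge_diff)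
  moreover have "sum f F - (sum f F - s) = s" by simp
  ultimately show ?thesis by (simp only:)
qed

text \<open>
  A non-archimedean series converges as soon as its terms tend to \<open>0\<close>: each coefficient of the
  sum involves finitely many terms only, and these coefficients define the limit.
\<close>

lemma summable_fls:
  fixes f :: "'b \<Rightarrow> 'a::field fls"
  assumes fin: "\<And>k. finite {i \<in> I. \<not> ord_ge k (f i)}"
  shows "f summable_on I"
proof -
  define G where "G k = {i \<in> I. \<not> ord_ge k (f i)}" for k
  have Gmono: "G j \<subseteq> G k" if "j \<le> k" for j k
    using that by (auto simp: G_def dest: ord_ge_mono[OF _ that])
  have finG: "finite (G k)" for k using fin by (simp add: G_def)
  \<comment> \<open>Terms outside \<open>G (j + 1)\<close> have no coefficient in degree \<open>j\<close>.\<close>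
  have coeff: "sum f F $$ j = sum f (G (j + 1)) $$ j" if "finite F" "F \<subseteq> I" "G (j + 1) \<subseteq> F" for F j
    unfolding fls_nth_sum using that by (intro sum.mono_neutral_right) (auto simp: G_def ord_ge_def)
  define c where "c k = sum f (G (k + 1)) $$ k" for k
  define N where "N = min 0 (fls_subdegree (sum f (G 0)))"
  have "c k = 0" if "k < N" for k
  proof -
    have "sum f (G 0) $$ k = c k"
      unfolding c_def using that finG Gmono[of "k+1" 0]
      by (intro coeff) (auto simp: N_def G_def)
    then show ?thesis using that by (simp add: N_def)
  qed
  then have s: "Abs_fls c $$ k = c k" for k
    by (intro nth_Abs_fls_lower_bound[of N]) auto
  have "(f has_sum Abs_fls c) I"
    unfolding has_sum_def tendsto_fls_iff
  proof
    fix m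
    have "ord_ge m (sum f F - Abs_fls c)" if "finite F" "G m \<subseteq> F" "F \<subseteq> I" for F
      unfolding ord_ge_def fls_minus_nth s c_def
    proof (intro allI impI)
      fix k assume "k < m"
      then have "G (k + 1) \<subseteq> F" using that(2) Gmono[of "k+1" m] by auto
      with that show "sum f F $$ k - sum f (G (k + 1)) $$ k = 0" by (simp add: coeff)
    qed
    then show "\<forall>\<^sub>F F in finite_subsets_at_top I. ord_ge m (sum f F - Abs_fls c)"
      unfolding eventually_finite_subsets_at_top using finG by (auto simp: G_def)
  qed
  then show ?thesis by (auto simp: summable_on_def)
qed

section \<open>Polynomials inside the Laurent series\<close>

lemma A_to_kinf_0 [simp]: "A_to_kinf 0 = 0"
  by (simp add: A_to_kinf_def)

lemma A_to_kinf_pCons: "A_to_kinf (pCons c p) = fls_const c + T_inf * A_to_kinf p"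
  by (simp add: A_to_kinf_def map_poly_pCons)

text \<open>
  The variable of the Laurent series is \<open>1/T\<close>, so the coefficient of \<open>T\<^sup>i\<close> sits at index \<open>-i\<close>.
\<close>

lemma A_to_kinf_nth: "A_to_kinf p $$ k = (if k \<le> 0 then coeff p (nat (- k)) else 0)"
proof (induction p arbitrary: k)
  case (pCons c p)
  show ?case
    by (auto simp: A_to_kinf_pCons T_inf_def fls_X_inv_times_conv_shift pCons.IH coeff_pCons
          nat_diff_distrib split: nat.splits)
qed simp

lemma A_to_kinf_add: "A_to_kinf (p + r) = A_to_kinf p + A_to_kinf r"
  by (intro fls_eqI) (simp add: A_to_kinf_nth)

lemma A_to_kinf_diff: "A_to_kinf (p - r) = A_to_kinf p - A_to_kinf r"
  by (intro fls_eqI) (simp add: A_to_kinf_nth)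

lemma A_to_kinf_minus: "A_to_kinf (- p) = - A_to_kinf p"
  by (intro fls_eqI) (simp add: A_to_kinf_nth)

lemma A_to_kinf_smult: "A_to_kinf (smult c p) = fls_const c * A_to_kinf p"
  by (intro fls_eqI) (simp add: A_to_kinf_nth)

lemma A_to_kinf_mult: "A_to_kinf (p * r) = A_to_kinf p * A_to_kinf r"
proof (induction p)
  case (pCons c p)
  then show ?case
    by (simp add: A_to_kinf_pCons A_to_kinf_add A_to_kinf_smult algebra_simps)
qed simp

lemma A_to_kinf_1 [simp]: "A_to_kinf 1 = 1"
  by (simp add: one_pCons A_to_kinf_pCons)

lemmas A_to_kinf_hom = A_to_kinf_add A_to_kinf_diff A_to_kinf_minus A_to_kinf_mult

lemma subdegree_A_to_kinf: "fls_subdegree (A_to_kinf p) = - int (degree p)"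
proof (cases "p = 0")
  case False
  then show ?thesis
    by (intro fls_subdegree_eqI) (auto simp: A_to_kinf_nth intro!: coeff_eq_0)
qed simp

lemma A_to_kinf_eq_iff [simp]: "A_to_kinf p = A_to_kinf r \<longleftrightarrow> p = r"
proof
  assume eq: "A_to_kinf p = A_to_kinf r"
  show "p = r"
  proof (rule poly_eqI)
    fix n show "coeff p n = coeff r n"
      using A_to_kinf_nth[of p "- int n"] A_to_kinf_nth[of r "- int n"] eq by simp
  qed
qed simp

lemma A_to_kinf_eq_0_iff [simp]: "A_to_kinf p = 0 \<longleftrightarrow> p = 0"
  using A_to_kinf_eq_iff[of p 0] by simp

lemma A_to_kinf_small: "ord_ge 1 (A_to_kinf p) \<Longrightarrow> p = 0"
  by (auto simp: ord_ge_iff subdegree_A_to_kinf)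

lemma ex_polynomial_part:
  fixes z :: "'a::{field,finite} fls"
  obtains u where "ord_ge 1 (z - A_to_kinf u)" 
proof
  show "ord_ge 1 (z - A_to_kinf (fls_prpart z + [:z $$ 0:]))"
    unfolding ord_ge_def
  proof (intro allI impI)
    fix k :: int assume "k < 1"
    then show "(z - A_to_kinf (fls_prpart z + [:z $$ 0:])) $$ k = 0"
      by (cases "k = 0") (auto simp: A_to_kinf_nth coeff_pCons split: nat.splits)
  qed
qed

lemma card_field_ge_2: "CARD('a::{field,finite}) \<ge> 2"
  using card_mono[of UNIV "{0, 1 :: 'a}"] by simp

text \<open>
  Coefficient functions parametrise the polynomials of bounded degree, which gives both their
  finiteness and their number.
\<close>

lemma degree_le_conv_image:
  "{p :: 'a::{field,finite} poly. degree p \<le> N}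
     = (\<lambda>g. \<Sum>i\<le>N. monom (g i) i) ` ({..N} \<rightarrow>\<^sub>E UNIV)" (is "?A = ?f ` ?B")
proof (intro equalityI subsetI)
  fix p :: "'a poly" assume "p \<in> ?A"
  then have "p = ?f (restrict (coeff p) {..N})"
    using poly_as_sum_of_monoms'[of p N] by simp
  then show "p \<in> ?f ` ?B" by (rule image_eqI[where x = "restrict (coeff p) {..N}"]) simp
next
  fix p :: "'a poly" assume "p \<in> ?f ` ?B"
  then obtain g where p: "p = ?f g" by blast
  have "degree (monom (g i) i) \<le> N" if "i \<le> N" for i
    using degree_monom_le[of "g i" i] that by simp
  then show "p \<in> ?A" unfolding p by (auto intro!: degree_sum_le)
qed

lemma finite_degree_le: "finite {p :: 'a::{field,finite} poly. degree p \<le> N}"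
  unfolding degree_le_conv_image by (intro finite_imageI finite_PiE) auto

lemma card_degree_le: "card {p :: 'a::{field,finite} poly. degree p \<le> N} = CARD('a) ^ Suc N"
proof -
  have "coeff (\<Sum>i\<le>N. monom (g i) i) j = g j" if "j \<le> N" for g :: "nat \<Rightarrow> 'a" and j
    using that by (simp add: coeff_sum)
  then have "inj_on (\<lambda>g. \<Sum>i\<le>N. monom (g i) i) ({..N} \<rightarrow>\<^sub>E (UNIV::'a set))"
    by (intro inj_onI PiE_ext) (assumption+, metis atMost_iff)
  then show ?thesis unfolding degree_le_conv_image by (simp add: card_image card_PiE)
qed

text \<open>
  Dirichlet's approximation theorem. There are \<open>q\<^bsup>N+1\<^esup>\<close> polynomials \<open>v\<close> of degree at most \<open>N\<close> but
  only \<open>q\<^sup>N\<close> possibilities for the coefficients of \<open>T\<^bsup>-1\<^esup>, \<dots>, T\<^bsup>-N\<^esup>\<close> in \<open>v z\<close>, so these agree for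
  two polynomials, and their difference is the required \<open>v\<close>.
\<close>

lemma dirichlet:
  fixes z :: "'a::{field,finite} fls"
  obtains u v where "v \<noteq> 0" "degree v \<le> N" "ord_ge (int N + 1) (A_to_kinf v * z - A_to_kinf u)"
proof -
  define c where "c v = restrict (\<lambda>k. (A_to_kinf v * z) $$ int k) {1..N}" for v
  have "c ` {v. degree v \<le> N} \<subseteq> {1..N} \<rightarrow>\<^sub>E UNIV" by (auto simp: c_def)
  then have "card (c ` {v. degree v \<le> N}) \<le> card ({1..N} \<rightarrow>\<^sub>E (UNIV::'a set))"
    by (intro card_mono finite_PiE) auto
  also have "\<dots> = CARD('a) ^ N" by (simp add: card_PiE)
  also have "\<dots> < card {v::'a poly. degree v \<le> N}"
    unfolding card_degree_le using card_field_ge_2[where 'a='a] by simp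
  finally have "\<not> inj_on c {v. degree v \<le> N}" by (rule pigeonhole)
  then obtain v1 v2 where v: "degree v1 \<le> N" "degree v2 \<le> N" "v1 \<noteq> v2" "c v1 = c v2"
    by (auto simp: inj_on_def)
  obtain u where u: "ord_ge 1 (A_to_kinf (v1 - v2) * z - A_to_kinf u)"
    by (rule ex_polynomial_part)
  have "ord_ge (int N + 1) (A_to_kinf (v1 - v2) * z - A_to_kinf u)"
    unfolding ord_ge_def
  proof (intro allI impI)
    fix k assume k: "k < int N + 1"
    show "(A_to_kinf (v1 - v2) * z - A_to_kinf u) $$ k = 0"
    proof (cases "k < 1")
      case True
      then show ?thesis using u by (simp add: ord_ge_def)
    next
      case False
      then have "nat k \<in> {1..N}" "int (nat k) = k" using k by auto
      then have "(A_to_kinf v1 * z) $$ k = (A_to_kinf v2 * z) $$ k"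
        using fun_cong[OF v(4), of "nat k"] by (simp add: c_def)
      then show ?thesis using False by (simp add: A_to_kinf_diff algebra_simps A_to_kinf_nth)
    qed
  qed
  then show thesis using v by (intro that[of "v1 - v2" u]) (auto intro: degree_diff_le)
qed

section \<open>A unit of norm 1\<close>

abbreviation lead :: "'a::zero fls \<Rightarrow> 'a" where
  "lead x \<equiv> x $$ fls_subdegree x"

lemma lead_mult: "lead (x * y) = lead x * lead y"
  for x :: "'a::field fls"
  by (cases "x = 0 \<or> y = 0") auto

lemma lead_A_to_kinf: "lead (A_to_kinf p) = lead_coeff p"
  by (simp add: subdegree_A_to_kinf A_to_kinf_nth)

lemma degree_mod_le: "b \<noteq> 0 \<Longrightarrow> degree (a mod b) \<le> degree b"
  for a b :: "'a::field poly"
  using degree_mod_less[of b a] by auto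

text \<open>
  Pell's equation in \<open>A[\<omega>]\<close>, by the classical argument. Dirichlet's theorem gives elements
  \<open>x\<^sub>N = u\<^sub>N + v\<^sub>N \<omega>\<close> tending to \<open>0\<close> whose norms have bounded degree. Infinitely many of them share
  the norm \<open>n\<^sub>0\<close>, the residues of \<open>u\<^sub>N\<close> and \<open>v\<^sub>N\<close> modulo \<open>n\<^sub>0\<close>, and the leading coefficient of the
  conjugate. The quotient of two such elements of different absolute value lies in \<open>A[\<omega>]\<close> and
  has norm \<open>1\<close>; sharing the leading coefficient makes that of the conjugate quotient \<open>1\<close>.
\<close>

lemma pell_unit:
  fixes \<omega> :: "'a::{field,finite} fls"
  assumes \<omega>: "\<omega> ^ 2 = A_to_kinf t * \<omega> - A_to_kinf n" and irr: "\<omega> \<notin> ratfuns"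
  obtains u v where "u ^ 2 + u * v * t + v ^ 2 * n = 1"
    "fls_subdegree (A_to_kinf u + A_to_kinf v * \<omega>) > 0"
    "lead (A_to_kinf u + A_to_kinf v * (A_to_kinf t - \<omega>)) = 1"
proof -
  define x where "x u v = A_to_kinf u + A_to_kinf v * \<omega>" for u v
  define x' where "x' u v = A_to_kinf u + A_to_kinf v * (A_to_kinf t - \<omega>)" for u v
  define nm where "nm u v = u ^ 2 + u * v * t + v ^ 2 * n" for u v :: "'a poly"
  have norm: "x u v * x' u v = A_to_kinf (nm u v)" for u v
  proof -
    have "x u v * x' u v = A_to_kinf u ^ 2 + A_to_kinf u * A_to_kinf v * A_to_kinf t
        + A_to_kinf v ^ 2 * (A_to_kinf t * \<omega> - \<omega> ^ 2)"
      by (simp add: x_def x'_def power2_eq_square algebra_simps)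
    moreover have "A_to_kinf t * \<omega> - \<omega> ^ 2 = A_to_kinf n" by (simp add: \<omega>)
    ultimately show ?thesis by (simp add: nm_def A_to_kinf_hom power2_eq_square)
  qed
  have x_neq_0: "x u v \<noteq> 0" if "v \<noteq> 0" for u v
  proof
    assume "x u v = 0"
    then have "\<omega> = A_to_kinf (- u) / A_to_kinf v"
      using that by (simp add: x_def A_to_kinf_minus field_simps eq_neg_iff_add_eq_0)
    then show False using irr that by (auto simp: ratfuns_def)
  qed
  \<comment> \<open>The conjugate of \<open>u + v \<omega>\<close> again lies in \<open>A[\<omega>]\<close>, because \<open>\<omega>' = t - \<omega>\<close>.\<close>
  have "x' u v = x (u + v * t) (- v)" for u v
    by (simp add: x_def x'_def A_to_kinf_hom algebra_simps)
  then have x'_neq_0: "x' u v \<noteq> 0" if "v \<noteq> 0" for u v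
    using that x_neq_0[of "- v"] by simp
  have "\<exists>u v. v \<noteq> 0 \<and> degree v \<le> N \<and> ord_ge (int N + 1) (x u v)" for N
  proof -
    obtain u v where "v \<noteq> 0" "degree v \<le> N" "ord_ge (int N + 1) (A_to_kinf v * \<omega> - A_to_kinf u)"
      by (rule dirichlet)
    then show ?thesis
      by (intro exI[of _ "- u"] exI[of _ v]) (simp add: x_def A_to_kinf_minus)
  qed
  then obtain U V where UV: "V N \<noteq> 0" "degree (V N) \<le> N" "ord_ge (int N + 1) (x (U N) (V N))" for N
    by metis
  define e where "e = \<bar>fls_subdegree (A_to_kinf t - \<omega> - \<omega>)\<bar>"
  define B where "B = {p :: 'a poly. degree p \<le> nat e}"
  have finB: "finite B" unfolding B_def by (rule finite_degree_le)
  \<comment> \<open>\<open>|x| < q\<^bsup>-N\<^esup>\<close> and \<open>|x'| \<le> max |x| |v (\<omega>' - \<omega>)| \<le> q\<^bsup>N+e\<^esup>\<close>, so the norm has degree below \<open>e\<close>.\<close>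
  have nm: "nm (U N) (V N) \<in> B" "nm (U N) (V N) \<noteq> 0" for N
  proof -
    have "ord_ge (- e) (A_to_kinf t - \<omega> - \<omega>)" "ord_ge (- int N) (A_to_kinf (V N))"
      using UV(2)[of N] by (auto simp: ord_ge_iff e_def subdegree_A_to_kinf)
    then have "ord_ge (- int N + - e) (A_to_kinf (V N) * (A_to_kinf t - \<omega> - \<omega>))"
      by (intro ord_ge_mult)
    moreover have "ord_ge (- int N + - e) (x (U N) (V N))"
      using UV(3)[of N] by (rule ord_ge_mono) (simp add: e_def)
    moreover have "x' (U N) (V N) = x (U N) (V N) + A_to_kinf (V N) * (A_to_kinf t - \<omega> - \<omega>)"
      by (simp add: x_def x'_def algebra_simps)
    ultimately have "ord_ge (- int N + - e) (x' (U N) (V N))"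
      using ord_ge_add by metis
    from ord_ge_mult[OF UV(3)[of N] this]
    have "ord_ge (1 - e) (A_to_kinf (nm (U N) (V N)))" by (simp add: norm)
    moreover have "A_to_kinf (nm (U N) (V N)) \<noteq> 0"
      unfolding norm[symmetric] using UV(1) x_neq_0 x'_neq_0 by auto
    ultimately show "nm (U N) (V N) \<in> B" "nm (U N) (V N) \<noteq> 0"
      by (auto simp: B_def ord_ge_iff subdegree_A_to_kinf)
  qed
  define D where "D N = (nm (U N) (V N), U N mod nm (U N) (V N), V N mod nm (U N) (V N),
      lead (x' (U N) (V N)))" for N
  have "D N \<in> B \<times> B \<times> B \<times> UNIV" for N
    using nm[of N] degree_mod_le[OF nm(2)[of N]] by (force simp: D_def B_def intro: order.trans)
  then have "range D \<subseteq> B \<times> B \<times> B \<times> UNIV" by blast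
  moreover have "finite (B \<times> B \<times> B \<times> (UNIV :: 'a set))"
    by (intro finite_cartesian_product finB finite)
  ultimately have "finite (range D)" by (rule finite_subset)
  then obtain j where "infinite {i \<in> UNIV. D i = D j}"
    using pigeonhole_infinite[of UNIV D] by blast
  \<comment> \<open>\<open>|x\<^sub>i| < q\<^bsup>-i\<^esup>\<close>, so this choice of \<open>i\<close> gives \<open>|x\<^sub>i| < |x\<^sub>j|\<close>.\<close>
  then obtain i where i: "D i = D j" "nat \<bar>fls_subdegree (x (U j) (V j))\<bar> < i"
    unfolding infinite_nat_iff_unbounded by blast
  define u1 v1 u2 v2 n0 where "u1 = U i" and "v1 = V i" and "u2 = U j" and "v2 = V j"
    and "n0 = nm (U j) (V j)"
  note defs = u1_def v1_def u2_def v2_def n0_def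
  have v0: "v1 \<noteq> 0" "v2 \<noteq> 0" and n0: "n0 \<noteq> 0" using UV nm by (auto simp: defs)
  have n0_eq: "n0 = nm u2 v2" "n0 = nm u1 v1" and lead_eq: "lead (x' u1 v1) = lead (x' u2 v2)"
    using i(1) by (auto simp: D_def defs)
  have "u1 mod n0 = u2 mod n0" "v1 mod n0 = v2 mod n0"
    using i(1) by (auto simp: D_def defs)
  then have dvd: "n0 dvd u1 - u2" "n0 dvd v1 - v2" by (simp_all add: mod_eq_dvd_iff)
  have sub_less: "fls_subdegree (x u2 v2) < fls_subdegree (x u1 v1)"
    using i(2) UV(3)[of i] x_neq_0[OF v0(1)] by (auto simp: ord_ge_iff defs)
  have "u1 * u2 + u1 * v2 * t + v1 * v2 * n = n0 + (u1 - u2) * (u2 + v2 * t) + (v1 - v2) * (v2 * n)"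
    by (simp add: n0_eq(1) nm_def power2_eq_square algebra_simps)
  then have "n0 dvd u1 * u2 + u1 * v2 * t + v1 * v2 * n" using dvd by (simp add: dvd_add)
  then obtain u where u: "u1 * u2 + u1 * v2 * t + v1 * v2 * n = n0 * u" by (auto elim: dvdE)
  have "v1 * u2 - u1 * v2 = (v1 - v2) * u2 - (u1 - u2) * v2" by (simp add: algebra_simps)
  then have "n0 dvd v1 * u2 - u1 * v2" using dvd by (simp add: dvd_diff)
  then obtain v where v: "v1 * u2 - u1 * v2 = n0 * v" by (auto elim: dvdE)
  have \<omega>2: "\<omega> * \<omega> = A_to_kinf t * \<omega> - A_to_kinf n" using \<omega> by (simp add: power2_eq_square)
  have \<omega>2': "\<omega> * (\<omega> * z) = (A_to_kinf t * \<omega> - A_to_kinf n) * z" for z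
    using \<omega>2 by (metis mult.assoc)
  have uA: "A_to_kinf n0 * A_to_kinf u
      = A_to_kinf u1 * A_to_kinf u2 + A_to_kinf u1 * A_to_kinf v2 * A_to_kinf t
        + A_to_kinf v1 * A_to_kinf v2 * A_to_kinf n"
    and vA: "A_to_kinf n0 * A_to_kinf v = A_to_kinf v1 * A_to_kinf u2 - A_to_kinf u1 * A_to_kinf v2"
    using arg_cong[OF u, of A_to_kinf] arg_cong[OF v, of A_to_kinf] by (simp_all add: A_to_kinf_hom)
  \<comment> \<open>So \<open>u + v \<omega>\<close> is \<open>x\<^sub>1 x\<^sub>2' / n\<^sub>0 = x\<^sub>1 / x\<^sub>2\<close>.\<close>
  have eta: "A_to_kinf n0 * x u v = x u1 v1 * x' u2 v2"
  proof -
    have "A_to_kinf n0 * x u v = A_to_kinf n0 * A_to_kinf u + A_to_kinf n0 * A_to_kinf v * \<omega>"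
      by (simp add: x_def algebra_simps)
    also have "\<dots> = x u1 v1 * x' u2 v2" unfolding uA vA
      by (simp add: x_def x'_def algebra_simps \<omega>2 \<omega>2')
    finally show ?thesis .
  qed
  have eta': "A_to_kinf n0 * x' u v = x' u1 v1 * x u2 v2"
  proof -
    have "A_to_kinf n0 * x' u v
        = A_to_kinf n0 * A_to_kinf u + A_to_kinf n0 * A_to_kinf v * (A_to_kinf t - \<omega>)"
      by (simp add: x'_def algebra_simps)
    also have "\<dots> = x' u1 v1 * x u2 v2" unfolding uA vA
      by (simp add: x_def x'_def algebra_simps \<omega>2 \<omega>2')
    finally show ?thesis .
  qed
  have "A_to_kinf n0 ^ 2 * A_to_kinf (nm u v) = (A_to_kinf n0 * x u v) * (A_to_kinf n0 * x' u v)"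
    by (simp add: norm[symmetric] power2_eq_square)
  also have "\<dots> = (x u1 v1 * x' u1 v1) * (x u2 v2 * x' u2 v2)"
    unfolding eta eta' by (simp add: mult_ac)
  also have "\<dots> = A_to_kinf n0 ^ 2"
    by (simp add: norm n0_eq(1)[symmetric] n0_eq(2)[symmetric] power2_eq_square)
  finally have "A_to_kinf (nm u v) = A_to_kinf 1" using n0 by simp
  then have nm1: "nm u v = 1" by (simp only: A_to_kinf_eq_iff)
  have x0: "x u v \<noteq> 0" "x' u v \<noteq> 0" using norm[of u v] nm1 by auto
  have nz: "x u1 v1 \<noteq> 0" "x' u1 v1 \<noteq> 0" "x u2 v2 \<noteq> 0" "x' u2 v2 \<noteq> 0"
    using x_neq_0 x'_neq_0 v0 by auto
  have "fls_subdegree (A_to_kinf n0) + fls_subdegree (x u v)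
      = fls_subdegree (x u1 v1) + fls_subdegree (x' u2 v2)"
    using arg_cong[OF eta, of fls_subdegree] n0 x0 nz by simp
  moreover have "fls_subdegree (A_to_kinf n0) = fls_subdegree (x u2 v2) + fls_subdegree (x' u2 v2)"
    using nz by (simp add: n0_eq(1) norm[symmetric])
  ultimately have "fls_subdegree (x u v) > 0" using sub_less by simp
  moreover have "lead (A_to_kinf n0) * lead (x' u v) = lead (A_to_kinf n0)"
  proof -
    have "lead (A_to_kinf n0) * lead (x' u v) = lead (x' u1 v1) * lead (x u2 v2)"
      using arg_cong[OF eta', of lead] by (simp only: lead_mult)
    also have "\<dots> = lead (x u2 v2 * x' u2 v2)" by (simp only: lead_eq lead_mult mult.commute)
    finally show ?thesis by (simp only: norm n0_eq(1))
  qed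
  then have "lead (x' u v) = 1" using n0 by simp
  ultimately show thesis using nm1 that[of u v] by (simp only: x_def x'_def nm_def)
qed

section \<open>Action of the unit on good approximations\<close>

text \<open>
  A root \<open>h\<close> of \<open>a X\<^sup>2 + b X + c\<close> together with a unit \<open>u + v a h\<close> as in \<open>pell_unit\<close>, applied to
  \<open>\<omega> = a h\<close>, for which \<open>\<omega>\<^sup>2 = - b \<omega> - a c\<close>. The conjugate of \<open>\<omega>\<close> is \<open>- b - \<omega>\<close>.
\<close>

locale quadratic_unit =
  fixes h :: "'a::{field,finite} fls" and a b c u v :: "'a poly"
  assumes h_irrational: "h \<notin> ratfuns"
    and a_neq_0: "a \<noteq> 0"
    and h_root: "A_to_kinf a * h ^ 2 + A_to_kinf b * h + A_to_kinf c = 0"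
    and norm_1: "u ^ 2 - u * v * b + v ^ 2 * a * c = 1"
    and unit_small: "fls_subdegree (A_to_kinf u + A_to_kinf v * (A_to_kinf a * h)) > 0"
    and conj_unit_monic:
      "lead (A_to_kinf u + A_to_kinf v * (- A_to_kinf b - A_to_kinf a * h)) = 1"
begin

definition h_conj :: "'a fls" where
  "h_conj = - A_to_kinf b / A_to_kinf a - h"

definition \<eta> :: "'a fls" where
  "\<eta> = A_to_kinf u + A_to_kinf v * (A_to_kinf a * h)"

definition \<eta>_conj :: "'a fls" where
  "\<eta>_conj = A_to_kinf u + A_to_kinf v * (A_to_kinf a * h_conj)"

definition lat :: "'a poly \<times> 'a poly \<Rightarrow> 'a fls" where
  "lat p = A_to_kinf (fst p) * h - A_to_kinf (snd p)"

definition lat_conj :: "'a poly \<times> 'a poly \<Rightarrow> 'a fls" where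
  "lat_conj p = A_to_kinf (fst p) * h_conj - A_to_kinf (snd p)"

text \<open>
  The matrix of multiplication by \<open>\<eta>\<close> on the module of all \<open>\<lambda> h - \<mu>\<close>, in the coordinates
  \<open>(\<lambda>, \<mu>)\<close>; it is obtained from \<open>a h\<^sup>2 = - b h - c\<close>. The inverse map is multiplication by the
  conjugate \<open>(u - v b) - v a h\<close>.
\<close>

definition act :: "'a poly \<times> 'a poly \<Rightarrow> 'a poly \<times> 'a poly" where
  "act p = (u * fst p - v * b * fst p - a * v * snd p, u * snd p + v * c * fst p)"

definition act_inv :: "'a poly \<times> 'a poly \<Rightarrow> 'a poly \<times> 'a poly" where
  "act_inv p = (u * fst p + a * v * snd p, (u - v * b) * snd p - v * c * fst p)"

definition approx :: "int \<Rightarrow> ('a poly \<times> 'a poly) set" where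
  "approx N = {p. lead_coeff (fst p) = 1 \<and> ord_ge N (lat p)}"

text \<open>
  From this scale on, small elements have large conjugates (see \<open>small_lat\<close>), and \<open>\<mu>\<close> is
  determined by \<open>\<lambda>\<close>.
\<close>

definition N0 :: int where
  "N0 = int (degree a) + 1"

lemma a_h_conj: "A_to_kinf a * h_conj = - A_to_kinf b - A_to_kinf a * h"
  using a_neq_0 by (simp add: h_conj_def field_simps)

lemma a_h_square: "A_to_kinf a * (h * h) = - A_to_kinf b * h - A_to_kinf c"
  using h_root by (simp add: power2_eq_square algebra_simps eq_neg_iff_add_eq_0)

lemma a_h_h_conj: "A_to_kinf a * (h * h_conj) = A_to_kinf c"
proof -
  have "A_to_kinf a * (h * h_conj) = h * (A_to_kinf a * h_conj)" by (simp add: mult_ac)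
  also have "\<dots> = - A_to_kinf b * h - A_to_kinf a * (h * h)" by (simp add: a_h_conj algebra_simps)
  finally show ?thesis by (simp add: a_h_square)
qed

lemma a_h_conj_square: "A_to_kinf a * (h_conj * h_conj) = - A_to_kinf b * h_conj - A_to_kinf c"
proof -
  have "A_to_kinf a * (h_conj * h_conj) = h_conj * (A_to_kinf a * h_conj)" by (simp add: mult_ac)
  also have "\<dots> = - A_to_kinf b * h_conj - A_to_kinf a * (h * h_conj)" by (simp add: a_h_conj algebra_simps)
  finally show ?thesis by (simp add: a_h_h_conj)
qed

lemma h_conj_irrational: "h_conj \<notin> ratfuns"
proof
  assume "h_conj \<in> ratfuns"
  then obtain x y where xy: "h_conj = A_to_kinf x / A_to_kinf y" "y \<noteq> 0" by (auto simp: ratfuns_def)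
  have "h = - A_to_kinf b / A_to_kinf a - h_conj" by (simp add: h_conj_def)
  also have "\<dots> = A_to_kinf (- b * y - a * x) / A_to_kinf (a * y)"
    using a_neq_0 xy by (simp add: A_to_kinf_hom field_simps)
  finally have "h \<in> ratfuns"
    unfolding ratfuns_def mem_Collect_eq using a_neq_0 xy(2) no_zero_divisors by blast
  then show False using h_irrational by simp
qed

lemma lat_neq_0: "p \<noteq> (0, 0) \<Longrightarrow> lat p \<noteq> 0" 
  and lat_conj_neq_0: "p \<noteq> (0, 0) \<Longrightarrow> lat_conj p \<noteq> 0" 
proof -
  have *: "A_to_kinf (fst p) * z - A_to_kinf (snd p) \<noteq> 0" if z: "z \<notin> ratfuns" and p: "p \<noteq> (0, 0)" for z
  proof
    assume eq: "A_to_kinf (fst p) * z - A_to_kinf (snd p) = 0"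
    then have "fst p \<noteq> 0" using p by (cases p) auto
    then have "z = A_to_kinf (snd p) / A_to_kinf (fst p)" using eq by (simp add: field_simps)
    then show False using z \<open>fst p \<noteq> 0\<close> by (auto simp: ratfuns_def)
  qed
  show "p \<noteq> (0, 0) \<Longrightarrow> lat p \<noteq> 0" unfolding lat_def using *[OF h_irrational] .
  show "p \<noteq> (0, 0) \<Longrightarrow> lat_conj p \<noteq> 0" unfolding lat_conj_def using *[OF h_conj_irrational] .
qed

lemma lat_zero: "lat (0, 0) = 0"
  by (simp add: lat_def)

lemma lat_act: "lat (act p) = \<eta> * lat p"
proof -
  have "\<eta> * lat p = A_to_kinf u * A_to_kinf (fst p) * h - A_to_kinf u * A_to_kinf (snd p)
      + A_to_kinf v * A_to_kinf (fst p) * (A_to_kinf a * (h * h))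
      - A_to_kinf v * A_to_kinf (snd p) * A_to_kinf a * h"
    by (simp add: \<eta>_def lat_def algebra_simps)
  also have "\<dots> = lat (act p)"
    unfolding a_h_square by (simp add: lat_def act_def A_to_kinf_hom algebra_simps)
  finally show ?thesis by simp
qed

lemma lat_conj_act: "lat_conj (act p) = \<eta>_conj * lat_conj p"
proof -
  have "\<eta>_conj * lat_conj p = A_to_kinf u * A_to_kinf (fst p) * h_conj - A_to_kinf u * A_to_kinf (snd p)
      + A_to_kinf v * A_to_kinf (fst p) * (A_to_kinf a * (h_conj * h_conj))
      - A_to_kinf v * A_to_kinf (snd p) * A_to_kinf a * h_conj"
    by (simp add: \<eta>_conj_def lat_conj_def algebra_simps)
  also have "\<dots> = lat_conj (act p)"
    unfolding a_h_conj_square by (simp add: lat_conj_def act_def A_to_kinf_hom algebra_simps)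
  finally show ?thesis by simp
qed

text \<open>
  The norm form of the lattice has values in \<open>A\<close>, so \<open>|x x'| \<ge> 1 / |a|\<close> at nonzero pairs: this is
  Liouville's lower bound for the approximation of \<open>h\<close>.
\<close>

lemma norm_lat:
  "A_to_kinf a * (lat p * lat_conj p)
     = A_to_kinf (c * fst p ^ 2 + b * fst p * snd p + a * snd p ^ 2)"
proof -
  have "A_to_kinf a * (lat p * lat_conj p) = A_to_kinf (fst p) ^ 2 * (A_to_kinf a * (h * h_conj))
      - A_to_kinf (fst p) * A_to_kinf (snd p) * (A_to_kinf a * h_conj)
      - A_to_kinf (fst p) * A_to_kinf (snd p) * (A_to_kinf a * h)
      + A_to_kinf a * A_to_kinf (snd p) ^ 2"
    by (simp add: lat_def lat_conj_def power2_eq_square algebra_simps)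
  then show ?thesis
    unfolding a_h_h_conj a_h_conj by (simp add: A_to_kinf_hom power2_eq_square algebra_simps)
qed

lemma eta_mult: "\<eta> * \<eta>_conj = 1"
proof -
  have "\<eta> * \<eta>_conj = A_to_kinf u ^ 2 + A_to_kinf u * A_to_kinf v * (A_to_kinf a * h_conj)
      + A_to_kinf u * A_to_kinf v * (A_to_kinf a * h)
      + A_to_kinf v ^ 2 * A_to_kinf a * (A_to_kinf a * (h * h_conj))"
    by (simp add: \<eta>_def \<eta>_conj_def power2_eq_square algebra_simps)
  also have "\<dots> = A_to_kinf (u ^ 2 - u * v * b + v ^ 2 * a * c)"
    unfolding a_h_h_conj a_h_conj by (simp add: A_to_kinf_hom power2_eq_square algebra_simps)
  finally show ?thesis by (simp add: norm_1)
qed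

lemma eta_neq_0: "\<eta> \<noteq> 0" "\<eta>_conj \<noteq> 0"
  using eta_mult by auto

lemma subdegree_eta: "fls_subdegree \<eta> > 0" "fls_subdegree \<eta>_conj = - fls_subdegree \<eta>"
  using unit_small fls_subdegree_mult[OF eta_neq_0] eta_mult by (simp_all add: \<eta>_def)

lemma lead_eta_conj: "lead \<eta>_conj = 1"
  using conj_unit_monic by (simp add: \<eta>_conj_def a_h_conj)

text \<open>
  The equation of \<open>h\<close> is separable, since \<open>\<eta>\<close> and its conjugate have different absolute values.
\<close>

lemma h_neq_h_conj: "h \<noteq> h_conj"
proof
  assume "h = h_conj"
  then have "\<eta> = \<eta>_conj" by (simp only: \<eta>_def \<eta>_conj_def)
  then have "fls_subdegree \<eta> = fls_subdegree \<eta>_conj" by (rule arg_cong)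
  then show False using subdegree_eta by linarith
qed

lemma act_act_inv: "act (act_inv p) = p" and act_inv_act: "act_inv (act p) = p"
proof -
  have "fst (act (act_inv p)) = (u ^ 2 - u * v * b + v ^ 2 * a * c) * fst p"
    "snd (act (act_inv p)) = (u ^ 2 - u * v * b + v ^ 2 * a * c) * snd p"
    "fst (act_inv (act p)) = (u ^ 2 - u * v * b + v ^ 2 * a * c) * fst p"
    "snd (act_inv (act p)) = (u ^ 2 - u * v * b + v ^ 2 * a * c) * snd p"
    by (simp_all add: act_def act_inv_def power2_eq_square algebra_simps)
  then show "act (act_inv p) = p" "act_inv (act p) = p"
    by (simp_all add: norm_1 prod_eq_iff)
qed

lemma lat_minus_lat_conj: "lat p - lat_conj p = A_to_kinf (fst p) * (h - h_conj)"
  by (simp add: lat_def lat_conj_def algebra_simps)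

text \<open>
  If \<open>x\<close> is small then \<open>x'\<close> is large by the norm form, so \<open>- x'\<close> is the dominant part of
  \<open>x - x' = \<lambda> (h - h')\<close> and determines the degree and the leading coefficient of \<open>\<lambda>\<close>.
\<close>

lemma small_lat:
  assumes p: "p \<noteq> (0, 0)" and N: "N \<ge> N0" "ord_ge N (lat p)"
  shows "fls_subdegree (lat_conj p) < 0" (is ?A)
    "fls_subdegree (lat_conj p) = fls_subdegree (h - h_conj) - int (degree (fst p))" (is ?B)
    "lead (lat_conj p) = - lead_coeff (fst p) * lead (h - h_conj)" (is ?C)
proof -
  have nz: "lat p \<noteq> 0" "lat_conj p \<noteq> 0" using p lat_neq_0 lat_conj_neq_0 by auto
  have "fls_subdegree (A_to_kinf a * (lat p * lat_conj p)) \<le> 0"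
    unfolding norm_lat subdegree_A_to_kinf by simp
  then have "fls_subdegree (lat p) + fls_subdegree (lat_conj p) \<le> int (degree a)"
    using nz a_neq_0 by (simp add: subdegree_A_to_kinf)
  moreover have "fls_subdegree (lat p) \<ge> N" using N nz by (simp add: ord_ge_iff)
  ultimately show ?A using N by (simp add: N0_def)
  then have less: "fls_subdegree (lat_conj p) < fls_subdegree (lat p)"
    using \<open>fls_subdegree (lat p) \<ge> N\<close> N by (simp add: N0_def)
  have eq: "- lat_conj p + lat p = A_to_kinf (fst p) * (h - h_conj)"
    using lat_minus_lat_conj[of p] by simp
  have sub: "fls_subdegree (A_to_kinf (fst p) * (h - h_conj)) = fls_subdegree (lat_conj p)"
    unfolding eq[symmetric] using nz less by (subst fls_subdegree_add_eq1) auto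
  have fst0: "fst p \<noteq> 0"
  proof
    assume "fst p = 0"
    then have "lat p = lat_conj p" using lat_minus_lat_conj[of p] by simp
    then show False using less by simp
  qed
  then show ?B using sub h_neq_h_conj by (simp add: subdegree_A_to_kinf)
  have "lead (A_to_kinf (fst p) * (h - h_conj)) = (- lat_conj p + lat p) $$ fls_subdegree (lat_conj p)"
    unfolding sub[symmetric] eq ..
  also have "\<dots> = - lead (lat_conj p)" using less by simp
  finally have "lead_coeff (fst p) * lead (h - h_conj) = - lead (lat_conj p)"
    unfolding lead_mult lead_A_to_kinf .
  then show ?C by simp
qed

lemma approx_neq_0: "p \<in> approx N \<Longrightarrow> p \<noteq> (0, 0)"
  by (auto simp: approx_def)

lemma lead_coeff_if_lead_lat_conj_eq:
  assumes "p \<noteq> (0, 0)" "N \<ge> N0" "ord_ge N (lat p)"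
    and "r \<noteq> (0, 0)" "M \<ge> N0" "ord_ge M (lat r)"
    and "lead (lat_conj p) = lead (lat_conj r)"
  shows "lead_coeff (fst p) = lead_coeff (fst r)"
proof -
  have eq: "- lead_coeff (fst p) * lead (h - h_conj) = - lead_coeff (fst r) * lead (h - h_conj)"
    using assms(7) unfolding small_lat(3)[OF assms(1-3)] small_lat(3)[OF assms(4-6)] .
  have "lead (h - h_conj) \<noteq> 0" using h_neq_h_conj by (intro nth_fls_subdegree_nonzero) simp
  from iffD1[OF mult_right_cancel[OF this] eq] show ?thesis by (rule iffD1[OF neg_equal_iff_equal])
qed

text \<open>
  Monicity is preserved because the leading coefficient of \<open>\<lambda>\<close> is visible in that of \<open>x'\<close>, which
  is multiplied by \<open>\<eta>'\<close>, of leading coefficient \<open>1\<close>.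
\<close>

lemma act_approx: 
  assumes N: "N \<ge> N0" and p: "p \<in> approx N"
  shows "act p \<in> approx (N + fls_subdegree \<eta>)"
proof -
  have nz: "p \<noteq> (0, 0)" "act p \<noteq> (0, 0)"
  proof -
    show "p \<noteq> (0, 0)" by (rule approx_neq_0[OF p])
    then have "lat (act p) \<noteq> 0" unfolding lat_act using lat_neq_0 eta_neq_0 by simp
    then show "act p \<noteq> (0, 0)" using lat_zero by auto
  qed
  have o: "ord_ge (N + fls_subdegree \<eta>) (lat (act p))"
    unfolding lat_act using p eta_neq_0 lat_neq_0[OF nz(1)] by (simp add: approx_def ord_ge_iff)
  have "lead_coeff (fst (act p)) = lead_coeff (fst p)"
  proof (rule lead_coeff_if_lead_lat_conj_eq[OF nz(2) _ o nz(1) N])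
    show "N0 \<le> N + fls_subdegree \<eta>" using N subdegree_eta(1) by linarith
    show "ord_ge N (lat p)" using p by (simp add: approx_def)
    show "lead (lat_conj (act p)) = lead (lat_conj p)" unfolding lat_conj_act lead_mult lead_eta_conj by simp
  qed
  then show ?thesis using p o by (simp add: approx_def)
qed

lemma act_inv_approx: 
  assumes N: "N \<ge> N0" and p: "p \<in> approx (N + fls_subdegree \<eta>)"
  shows "act_inv p \<in> approx N"
proof -
  have eq: "lat p = \<eta> * lat (act_inv p)" "lat_conj p = \<eta>_conj * lat_conj (act_inv p)"
    using lat_act[of "act_inv p"] lat_conj_act[of "act_inv p"] by (simp_all add: act_act_inv)
  have nz: "p \<noteq> (0, 0)" "act_inv p \<noteq> (0, 0)"
  proof -
    show "p \<noteq> (0, 0)" by (rule approx_neq_0[OF p])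
    then have "lat p \<noteq> 0" by (rule lat_neq_0)
    then show "act_inv p \<noteq> (0, 0)" using eq(1) lat_zero by auto
  qed
  have "ord_ge N (lat (act_inv p))"
    using p eta_neq_0 lat_neq_0[OF nz(2)] by (simp add: approx_def ord_ge_iff eq(1))
  moreover have "lead_coeff (fst (act_inv p)) = lead_coeff (fst p)"
  proof (rule lead_coeff_if_lead_lat_conj_eq[OF nz(2) N calculation nz(1)])
    show "N0 \<le> N + fls_subdegree \<eta>" using N subdegree_eta(1) by linarith
    show "ord_ge (N + fls_subdegree \<eta>) (lat p)" using p by (simp add: approx_def)
    show "lead (lat_conj (act_inv p)) = lead (lat_conj p)" unfolding eq(2) lead_mult lead_eta_conj by simp
  qed
  ultimately show ?thesis using p by (simp add: approx_def)
qed

lemma bij_betw_act: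
  assumes "N \<ge> N0"
  shows "bij_betw act (approx N) (approx (N + fls_subdegree \<eta>))"
  by (rule bij_betw_byWitness[where f' = act_inv])
     (use assms act_approx act_inv_approx act_act_inv act_inv_act in blast)+

lemma bij_betw_act_funpow:
  assumes "N \<ge> N0"
  shows "bij_betw (act ^^ l) (approx N) (approx (N + int l * fls_subdegree \<eta>))"
proof (induction l)
  case (Suc l)
  have "N + int l * fls_subdegree \<eta> \<ge> N0" using assms subdegree_eta(1) by (simp add: add_increasing2)
  from bij_betw_trans[OF Suc bij_betw_act[OF this]] show ?case
    by (simp add: algebra_simps o_def)
qed (simp add: bij_betw_def)

lemma lat_act_funpow: "lat ((act ^^ l) p) = \<eta> ^ l * lat p" "lat_conj ((act ^^ l) p) = \<eta>_conj ^ l * lat_conj p"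
  by (induction l) (simp_all add: lat_act lat_conj_act)

lemma inj_on_fst_approx: "N \<ge> 1 \<Longrightarrow> inj_on fst (approx N)"
proof (rule inj_onI)
  fix p r assume N: "N \<ge> 1" and pr: "p \<in> approx N" "r \<in> approx N" "fst p = fst r"
  have "ord_ge N (lat p - lat r)" using pr by (auto simp: approx_def intro: ord_ge_diff)
  moreover have "lat p - lat r = A_to_kinf (snd r - snd p)" using pr by (simp add: lat_def A_to_kinf_hom)
  ultimately have "snd r - snd p = 0" using N by (metis A_to_kinf_small ord_ge_mono)
  then show "p = r" using pr by (simp add: prod_eq_iff)
qed

lemma normalized_in_approx:
  assumes "z \<noteq> 0" "ord_ge N (lat (z, w))"
  shows "(smult (inverse (lead_coeff z)) z, smult (inverse (lead_coeff z)) w) \<in> approx N"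
proof -
  define k where "k = inverse (lead_coeff z)"
  have "ord_ge 0 (fls_const k)" by (simp add: ord_ge_def)
  from ord_ge_mult[OF this assms(2)] have "ord_ge N (fls_const k * lat (z, w))" by simp
  also have "fls_const k * lat (z, w) = lat (smult k z, smult k w)"
    by (simp add: lat_def A_to_kinf_smult algebra_simps)
  finally show ?thesis using assms(1) by (simp add: approx_def k_def)
qed

lemma approx_nonempty: "approx N \<noteq> {}"
proof -
  obtain w z where w: "z \<noteq> 0" "ord_ge (int (nat N) + 1) (A_to_kinf z * h - A_to_kinf w)"
    by (rule dirichlet)
  then have "ord_ge N (lat (z, w))" by (auto simp: lat_def elim: ord_ge_mono)
  from normalized_in_approx[OF w(1) this] show ?thesis by blast
qed

text \<open>
  The admissible \<open>\<lambda>\<close> form a vector space, so the difference of two distinct monic ones of the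
  same degree, made monic, would be admissible of smaller degree.
\<close>

lemma unique_minimal_degree:
  assumes N: "N \<ge> 1"
  obtains p0 where "p0 \<in> approx N" "\<And>p. p \<in> approx N \<Longrightarrow> p \<noteq> p0 \<Longrightarrow> degree (fst p) > degree (fst p0)"
proof -
  obtain p1 where p1: "p1 \<in> approx N" using approx_nonempty[of N] by blast
  from ex_has_least_nat[of "\<lambda>p. p \<in> approx N", OF p1, of "\<lambda>p. degree (fst p)"]
  obtain p0 where p0: "p0 \<in> approx N" "\<And>p. p \<in> approx N \<Longrightarrow> degree (fst p0) \<le> degree (fst p)"
    by blast
  have "degree (fst p) > degree (fst p0)" if p: "p \<in> approx N" "p \<noteq> p0" for p
  proof (rule ccontr)
    assume "\<not> degree (fst p) > degree (fst p0)"
    then have deg: "degree (fst p) = degree (fst p0)" using p0 p by (simp add: le_antisym)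
    define z where "z = fst p - fst p0"
    have z: "z \<noteq> 0" using inj_on_fst_approx[OF N] p p0(1) by (auto simp: z_def inj_on_def)
    have less: "degree z < degree (fst p0)"
    proof (rule ccontr)
      assume "\<not> degree z < degree (fst p0)"
      then have "degree z = degree (fst p0)"
        using degree_diff_le_max[of "fst p" "fst p0"] deg by (simp add: z_def)
      then have "lead_coeff z = lead_coeff (fst p) - lead_coeff (fst p0)"
        by (simp add: deg z_def)
      then show False using p p0(1) z by (simp add: approx_def)
    qed
    have "lat (z, snd p - snd p0) = lat p - lat p0"
      by (simp add: lat_def z_def A_to_kinf_hom algebra_simps)
    then have "ord_ge N (lat (z, snd p - snd p0))"
      using p p0(1) by (simp only: approx_def mem_Collect_eq ord_ge_diff)
    from p0(2)[OF normalized_in_approx[OF z this]] less z show False by simp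
  qed
  with p0(1) show thesis by (rule that)
qed

end

section \<open>Convergence of the zeta quotients along orbits\<close>

lemma ord_ge_power_diff:
  fixes x y :: "'a::field fls"
  assumes "ord_ge 0 x" "ord_ge 0 y" "ord_ge m (x - y)"
  shows "ord_ge m (x ^ n - y ^ n)"
proof (induction n)
  case (Suc n)
  have "x ^ Suc n - y ^ Suc n = x * (x ^ n - y ^ n) + (x - y) * y ^ n"
    by (simp add: algebra_simps)
  moreover have "ord_ge (0 + m) (x * (x ^ n - y ^ n))" using assms(1) Suc by (rule ord_ge_mult)
  moreover have "ord_ge (m + 0) ((x - y) * y ^ n)"
    using assms(3) ord_ge_power[OF assms(2), of n] by (intro ord_ge_mult) simp_all
  ultimately show ?case by (simp add: ord_ge_add)
qed simp

context quadratic_unit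
begin

text \<open>
  Up to the factor \<open>- \<eta>'\<^sup>l / (h - h')\<close>, the first coordinate of \<open>\<eta>\<^sup>l (\<lambda>, \<mu>)\<close> is
  \<open>x' - \<theta>\<^sup>l x\<close>, which is \<open>perturbed l (\<lambda>, \<mu>)\<close>.
\<close>

definition \<theta> :: "'a fls" where
  "\<theta> = \<eta> / \<eta>_conj"

definition perturbed :: "nat \<Rightarrow> 'a poly \<times> 'a poly \<Rightarrow> 'a fls" where
  "perturbed l p = lat_conj p - \<theta> ^ l * lat p"

definition zeta_approx :: "int \<Rightarrow> nat \<Rightarrow> 'a fls" where
  "zeta_approx N n = (\<Sum>\<^sub>\<infinity>p\<in>approx N. inverse (A_to_kinf (fst p)) ^ n)"

definition zeta_conj :: "int \<Rightarrow> nat \<Rightarrow> 'a fls" where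
  "zeta_conj N n = (\<Sum>\<^sub>\<infinity>p\<in>approx N. inverse (lat_conj p) ^ n)"

lemma subdegree_theta: "fls_subdegree \<theta> > 0"
  using subdegree_eta eta_neq_0 by (simp add: \<theta>_def subdegree_divide)

lemma ord_ge_theta_lat:
  assumes N: "N \<ge> N0" and p: "p \<in> approx N"
  shows "ord_ge (int l) (\<theta> ^ l * lat p)"
proof -
  have "ord_ge 1 \<theta>" using subdegree_theta by (simp add: ord_ge_iff)
  from ord_ge_power[OF this] have "ord_ge (int l) (\<theta> ^ l)" by simp
  moreover have "ord_ge 0 (lat p)" using p N by (auto simp: approx_def N0_def elim: ord_ge_mono)
  ultimately have "ord_ge (int l + 0) (\<theta> ^ l * lat p)" by (rule ord_ge_mult)
  then show ?thesis by simp
qed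

lemma subdegree_lat_conj:
  assumes N: "N \<ge> N0" and p: "p \<in> approx N"
  shows "lat_conj p \<noteq> 0" "fls_subdegree (lat_conj p) < 0"
    "fls_subdegree (lat_conj p) = fls_subdegree (h - h_conj) - int (degree (fst p))"
  using small_lat(1,2)[OF approx_neq_0[OF p] N] lat_conj_neq_0[OF approx_neq_0[OF p]] p by (auto simp: approx_def)

lemma subdegree_perturbed:
  assumes N: "N \<ge> N0" and p: "p \<in> approx N"
  shows "fls_subdegree (perturbed l p) = fls_subdegree (lat_conj p)"
proof (cases "\<theta> ^ l * lat p = 0")
  case False
  then have "fls_subdegree (\<theta> ^ l * lat p) \<ge> int l"
    using ord_ge_theta_lat[OF N p, of l] unfolding ord_ge_iff by blast
  then have "fls_subdegree (lat_conj p) < fls_subdegree (\<theta> ^ l * lat p)"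
    using subdegree_lat_conj(2)[OF N p] by linarith
  then show ?thesis
    unfolding perturbed_def using subdegree_lat_conj(1)[OF N p] by (rule fls_subdegree_diff_eq1[rotated])
next
  case True
  show ?thesis unfolding perturbed_def True by simp
qed

lemma ord_ge_inverse_1:
  assumes "fls_subdegree (x :: 'a fls) < 0"
  shows "ord_ge 1 (inverse x)"
  using assms by (simp add: ord_ge_iff subdegree_inverse)

text \<open>
  The degree of \<open>\<lambda>\<close> determines \<open>|x'|\<close>, and only finitely many \<open>\<lambda>\<close> have a given degree, so the
  terms tend to \<open>0\<close>.
\<close>

lemma summable_inverse_power:
  fixes w :: "'a poly \<times> 'a poly \<Rightarrow> 'a fls"
  assumes N: "N \<ge> N0" and n: "n \<ge> 1"
    and w: "\<And>p. p \<in> approx N \<Longrightarrow> fls_subdegree (w p) = fls_subdegree (lat_conj p)"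
  shows "(\<lambda>p. inverse (w p) ^ n) summable_on approx N"
proof (rule summable_fls)
  fix k
  define D where "D = nat (k + fls_subdegree (h - h_conj))"
  have "degree (fst p) \<le> D" if p: "p \<in> approx N" "\<not> ord_ge k (inverse (w p) ^ n)" for p
  proof -
    have "- fls_subdegree (lat_conj p) \<le> int n * (- fls_subdegree (lat_conj p))"
      using subdegree_lat_conj(2)[OF N p(1)] n mult_right_mono[of 1 "int n" "- fls_subdegree (lat_conj p)"]
      by simp
    also have "\<dots> = fls_subdegree (inverse (w p) ^ n)"
      using w[OF p(1)] by (simp add: fls_subdegree_pow subdegree_inverse)
    also have "\<dots> < k" using p(2) by (simp add: ord_ge_iff not_le)
    finally show ?thesis unfolding subdegree_lat_conj(3)[OF N p(1)] D_def by linarith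
  qed
  then have sub: "fst ` {p \<in> approx N. \<not> ord_ge k (inverse (w p) ^ n)} \<subseteq> {z. degree z \<le> D}" by auto
  have "inj_on fst (approx N)" using N by (intro inj_on_fst_approx) (simp add: N0_def)
  then have "inj_on fst {p \<in> approx N. \<not> ord_ge k (inverse (w p) ^ n)}"
    by (rule inj_on_subset) auto
  then show "finite {p \<in> approx N. \<not> ord_ge k (inverse (w p) ^ n)}"
    by (rule finite_imageD[OF finite_subset[OF sub finite_degree_le]])
qed

text \<open>
  Since \<open>|x'|\<close> and \<open>|x' - \<theta>\<^sup>l x|\<close> are both larger than \<open>1\<close>, the two terms at each index differ
  by at most \<open>|\<theta>\<^sup>l x| \<le> q\<^bsup>-l\<^esup>\<close>. The bound is uniform in the index and therefore, by the
  ultrametric inequality, holds for the sums as well.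
\<close>

lemma perturbed_tendsto:
  assumes N: "N \<ge> N0" and n: "n \<ge> 1"
  shows "(\<lambda>l. \<Sum>\<^sub>\<infinity>p\<in>approx N. inverse (perturbed l p) ^ n) \<longlonglongrightarrow> zeta_conj N n"
  unfolding tendsto_fls_iff
proof
  fix m :: int
  have "ord_ge (int l) ((\<Sum>\<^sub>\<infinity>p\<in>approx N. inverse (perturbed l p) ^ n) - zeta_conj N n)" for l
  proof -
    have "((\<lambda>p. inverse (perturbed l p) ^ n + - (inverse (lat_conj p) ^ n)) has_sum
        (\<Sum>\<^sub>\<infinity>p\<in>approx N. inverse (perturbed l p) ^ n) + - zeta_conj N n) (approx N)"
      unfolding zeta_conj_def
      by (intro has_sum_add has_sum_uminusI has_sum_infsum summable_inverse_power N n
          subdegree_perturbed[OF N] refl)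
    then show ?thesis unfolding add_uminus_conv_diff
    proof (rule ord_ge_has_sum)
      fix p assume p: "p \<in> approx N"
      have sub: "fls_subdegree (perturbed l p) < 0" "fls_subdegree (lat_conj p) < 0"
        using subdegree_perturbed[OF N p] subdegree_lat_conj[OF N p] by auto
      then have nz: "perturbed l p \<noteq> 0" "lat_conj p \<noteq> 0" by auto
      have inv: "ord_ge 1 (inverse (perturbed l p))" "ord_ge 1 (inverse (lat_conj p))"
        using sub ord_ge_inverse_1 by auto
      have "inverse (perturbed l p) - inverse (lat_conj p)
          = (\<theta> ^ l * lat p) * (inverse (perturbed l p) * inverse (lat_conj p))"
        using nz by (simp add: perturbed_def field_simps)
      moreover have "ord_ge (int l + (1 + 1))
          ((\<theta> ^ l * lat p) * (inverse (perturbed l p) * inverse (lat_conj p)))"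
        by (intro ord_ge_mult ord_ge_theta_lat[OF N p] inv)
      ultimately have "ord_ge (int l) (inverse (perturbed l p) - inverse (lat_conj p))"
        by (auto elim: ord_ge_mono)
      then show "ord_ge (int l) (inverse (perturbed l p) ^ n - inverse (lat_conj p) ^ n)"
        by (intro ord_ge_power_diff inv[THEN ord_ge_mono]) auto
    qed
  qed
  then show "\<forall>\<^sub>F l in sequentially. ord_ge m
      ((\<Sum>\<^sub>\<infinity>p\<in>approx N. inverse (perturbed l p) ^ n) - zeta_conj N n)"
    by (intro eventually_sequentiallyI[of "nat m"]) (rule ord_ge_mono, auto)
qed

text \<open>
  The element with \<open>\<lambda>\<close> of least degree has the smallest \<open>|x'|\<close>, so its term is strictly larger
  than the sum of all others.
\<close>

lemma zeta_conj_neq_0: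
  assumes N: "N \<ge> N0" and n: "n \<ge> 1"
  shows "zeta_conj N n \<noteq> 0"
proof -
  obtain p0 where p0: "p0 \<in> approx N" "\<And>p. p \<in> approx N \<Longrightarrow> p \<noteq> p0 \<Longrightarrow> degree (fst p) > degree (fst p0)"
    using unique_minimal_degree[of N] N by (auto simp: N0_def)
  define R where "R = (\<Sum>\<^sub>\<infinity>p\<in>approx N - {p0}. inverse (lat_conj p) ^ n)"
  define s where "s = fls_subdegree (inverse (lat_conj p0) ^ n)"
  have sub: "fls_subdegree (inverse (lat_conj p) ^ n)
      = int n * (int (degree (fst p)) - fls_subdegree (h - h_conj))" if "p \<in> approx N" for p
    by (simp add: fls_subdegree_pow subdegree_inverse subdegree_lat_conj(3)[OF N that])
  have all: "(\<lambda>p. inverse (lat_conj p) ^ n) summable_on approx N"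
    by (rule summable_inverse_power[OF N n refl])
  have "(\<lambda>p. inverse (lat_conj p) ^ n) summable_on approx N - {p0}"
    by (rule summable_on_cofin_subset[OF all]) simp
  then have R: "((\<lambda>p. inverse (lat_conj p) ^ n) has_sum R) (approx N - {p0})"
    unfolding R_def by (rule has_sum_infsum)
  have "ord_ge (s + 1) R"
    using R
  proof (rule ord_ge_has_sum)
    fix p assume p: "p \<in> approx N - {p0}"
    then have "int (degree (fst p0)) + 1 \<le> int (degree (fst p))" using p0(2)[of p] by simp
    then have "int n * (int (degree (fst p0)) - fls_subdegree (h - h_conj)) + 1
        \<le> int n * (int (degree (fst p)) - fls_subdegree (h - h_conj))"
      using n mult_left_mono[of "int (degree (fst p0)) + 1" "int (degree (fst p))" "int n"]
      by (simp add: algebra_simps)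
    then show "ord_ge (s + 1) (inverse (lat_conj p) ^ n)"
      using p p0(1) by (simp add: ord_ge_iff s_def sub)
  qed
  then have "R $$ s = 0" by (simp add: ord_ge_def)
  moreover have "(inverse (lat_conj p0) ^ n) $$ s \<noteq> 0"
    unfolding s_def using subdegree_lat_conj(1)[OF N p0(1)] by (intro nth_fls_subdegree_nonzero) simp
  moreover have "zeta_conj N n = inverse (lat_conj p0) ^ n + R"
    unfolding zeta_conj_def using has_sum_insert[OF _ R, of p0] p0(1)
    by (intro infsumI) (simp add: insert_absorb)
  ultimately have "zeta_conj N n $$ s \<noteq> 0" by simp
  then show ?thesis by auto
qed

text \<open>
  Reindexing along the bijection \<open>\<eta>\<^sup>l\<close> transports the sum at scale \<open>N + l m\<close> to one over
  \<open>approx N\<close>, where a common factor comes out.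
\<close>

lemma zeta_approx_shift:
  assumes N: "N \<ge> N0"
  shows "zeta_approx (N + int l * fls_subdegree \<eta>) n
    = (- (h - h_conj) / \<eta>_conj ^ l) ^ n * (\<Sum>\<^sub>\<infinity>p\<in>approx N. inverse (perturbed l p) ^ n)"
proof -
  have eq: "inverse (A_to_kinf (fst ((act ^^ l) p)))
      = (- (h - h_conj) / \<eta>_conj ^ l) * inverse (perturbed l p)" for p
  proof -
    have "A_to_kinf (fst ((act ^^ l) p)) * (h - h_conj) = \<eta> ^ l * lat p - \<eta>_conj ^ l * lat_conj p"
      by (simp add: lat_minus_lat_conj[symmetric] lat_act_funpow)
    also have "\<dots> = - (\<eta>_conj ^ l) * perturbed l p"
      using eta_neq_0 by (simp add: perturbed_def \<theta>_def field_simps)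
    finally have "A_to_kinf (fst ((act ^^ l) p)) = - (\<eta>_conj ^ l) * perturbed l p / (h - h_conj)"
      using h_neq_h_conj by (simp add: field_simps)
    then show ?thesis using minus_divide_left[of "h - h_conj"]
      by (simp add: field_simps inverse_eq_divide)
  qed
  have "zeta_approx (N + int l * fls_subdegree \<eta>) n
      = (\<Sum>\<^sub>\<infinity>p\<in>approx N. inverse (A_to_kinf (fst ((act ^^ l) p))) ^ n)"
    unfolding zeta_approx_def by (rule infsum_reindex_bij_betw[OF bij_betw_act_funpow[OF N], symmetric])
  also have "\<dots> = (\<Sum>\<^sub>\<infinity>p\<in>approx N. (- (h - h_conj) / \<eta>_conj ^ l) ^ n * inverse (perturbed l p) ^ n)"
    unfolding eq power_mult_distrib ..
  finally show ?thesis by (simp only: infsum_cmult_right')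
qed

definition J_approx :: "int \<Rightarrow> 'a fls" where
  "J_approx N = zeta_approx N (CARD('a)^2 - 1) / zeta_approx N (CARD('a) - 1) ^ (CARD('a) + 1)"

lemma J_approx_tendsto:
  assumes N: "N \<ge> N0"
  shows "(\<lambda>l. J_approx (N + int l * fls_subdegree \<eta>)) \<longlonglongrightarrow>
     zeta_conj N (CARD('a)^2 - 1) / zeta_conj N (CARD('a) - 1) ^ (CARD('a) + 1)"
proof -
  define Z where "Z l n = (\<Sum>\<^sub>\<infinity>p\<in>approx N. inverse (perturbed l p) ^ n)" for l n
  define q where "q = CARD('a)"
  have q: "q \<ge> 2" unfolding q_def by (rule card_field_ge_2)
  have q2: "q ^ 2 - 1 = (q - 1) * (q + 1)"
    by (cases q) (simp_all add: power2_eq_square algebra_simps)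
  have n: "q - 1 \<ge> 1" "q ^ 2 - 1 \<ge> 1"
    using q mult_le_mono[of 1 "q - 1" 1 "q + 1"] unfolding q2 by linarith+
  \<comment> \<open>The scalars cancel because \<open>q\<^sup>2 - 1 = (q - 1) (q + 1)\<close>.\<close>
  have J: "J_approx (N + int l * fls_subdegree \<eta>) = Z l (q ^ 2 - 1) / Z l (q - 1) ^ (q + 1)" for l
  proof -
    define s where "s = - (h - h_conj) / \<eta>_conj ^ l"
    have s: "s \<noteq> 0" using h_neq_h_conj eta_neq_0 by (auto simp: s_def)
    have "s ^ (q ^ 2 - 1) = (s ^ (q - 1)) ^ (q + 1)"
      by (simp only: q2 power_mult)
    then show ?thesis
      unfolding J_approx_def zeta_approx_shift[OF N] q_def[symmetric] s_def[symmetric] Z_def[symmetric]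
        power_mult_distrib
      using s by (simp del: power_Suc add_Suc_right)
  qed
  show ?thesis unfolding J q_def[symmetric]
    by (intro tendsto_divide_fls tendsto_power_fls)
       (use perturbed_tendsto[OF N] zeta_conj_neq_0[OF N] n in \<open>auto simp: Z_def\<close>)
qed

end

section \<open>Scales, and limits with the point at infinity\<close>

lemma card_gt_1_real: "real CARD('a::{field,finite}) > 1"
  using card_field_ge_2[where 'a='a] by simp

lemma abs_inf_le_if_ord_ge:
  fixes x :: "'a::{field,finite} fls"
  assumes "ord_ge k x"
  shows "abs_inf x \<le> real CARD('a) powi (- k)"
  using assms card_gt_1_real[where 'a='a]
  by (auto simp: abs_inf_def ord_ge_iff intro!: power_int_increasing)

lemma abs_inf_ge_if_ord_ge_inverse:
  fixes x :: "'a::{field,finite} fls"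
  assumes "ord_ge k (inverse x)" "x \<noteq> 0"
  shows "abs_inf x \<ge> real CARD('a) powi k"
  using assms card_gt_1_real[where 'a='a]
  by (auto simp: abs_inf_def ord_ge_iff subdegree_inverse intro!: power_int_increasing)

lemma abs_inf_less_iff:
  fixes x :: "'a::{field,finite} fls"
  assumes N: "real CARD('a) powi (- N) < \<epsilon>" "\<epsilon> \<le> real CARD('a) powi (1 - N)"
  shows "abs_inf x < \<epsilon> \<longleftrightarrow> ord_ge N x"
proof
  assume "ord_ge N x"
  from abs_inf_le_if_ord_ge[OF this] show "abs_inf x < \<epsilon>" using N by simp
next
  assume less: "abs_inf x < \<epsilon>"
  show "ord_ge N x"
  proof (rule ccontr)
    assume "\<not> ord_ge N x"
    then have "x \<noteq> 0" "1 - N \<le> - fls_subdegree x" by (auto simp: ord_ge_iff)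
    then have "real CARD('a) powi (1 - N) \<le> abs_inf x"
      using card_gt_1_real[where 'a='a] by (auto simp: abs_inf_def intro!: power_int_increasing)
    then show False using less N by simp
  qed
qed

text \<open>
  The values of the absolute value are integral powers of \<open>q\<close>, so the condition \<open>|x| < \<epsilon>\<close>
  depends only on the \<open>N\<close> found here.
\<close>

lemma ex_scale:
  fixes q \<epsilon> :: real
  assumes "q > 1" "\<epsilon> > 0"
  obtains N :: int where "q powi (- N) < \<epsilon>" "\<epsilon> \<le> q powi (1 - N)"
proof
  define N where "N = \<lfloor>- log q \<epsilon>\<rfloor> + 1"
  have N: "real_of_int (- N) < log q \<epsilon>" "log q \<epsilon> \<le> real_of_int (1 - N)"
    unfolding N_def by linarith+
  have eq: "q powi k = q powr real_of_int k" for k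
    using assms by (simp add: powr_real_of_int')
  show "q powi (- N) < \<epsilon>" "\<epsilon> \<le> q powi (1 - N)"
    unfolding eq using N assms by (simp_all add: less_log_iff log_le_iff)
qed

lemma dist_A_less_iff: "dist_A x < \<epsilon> \<longleftrightarrow> (\<exists>\<alpha>. abs_inf (x - A_to_kinf \<alpha>) < \<epsilon>)"
proof -
  have "bdd_below (range (\<lambda>\<alpha>. abs_inf (x - A_to_kinf \<alpha>)))"
    by (intro bdd_belowI[of _ 0]) (auto simp: abs_inf_def)
  then show ?thesis unfolding dist_A_def by (subst cINF_less_iff) auto
qed

lemma converges_to_compose:
  assumes "converges_to s L" "filterlim g sequentially sequentially"
  shows "converges_to (\<lambda>i. s (g i)) L"
proof (cases L)
  case None
  have "\<forall>\<^sub>F i in sequentially. \<forall>y. s (g i) = Some y \<longrightarrow> abs_inf y > B" for B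
    using assms(1) eventually_compose_filterlim[OF _ assms(2), of "\<lambda>i. \<forall>y. s i = Some y \<longrightarrow> abs_inf y > B"]
    by (auto simp: converges_to_def None)
  then show ?thesis by (simp add: converges_to_def None)
next
  case (Some x)
  then obtain y where y: "\<forall>\<^sub>F i in sequentially. s i = Some (y i)" "y \<longlonglongrightarrow> x"
    using assms(1) by (auto simp: converges_to_def)
  have "\<forall>\<^sub>F i in sequentially. s (g i) = Some (y (g i))"
    using eventually_compose_filterlim[OF y(1) assms(2)] .
  moreover have "(\<lambda>i. y (g i)) \<longlonglongrightarrow> x" using filterlim_compose[OF y(2) assms(2)] .
  ultimately show ?thesis by (auto simp: converges_to_def Some)
qed

text \<open>
  A sequence with a finite limit stays in a ball, so it does not tend to \<open>\<infinity>\<close>.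
\<close>

lemma converges_to_Some_not_None:
  assumes "converges_to s (Some x)"
  shows "\<not> converges_to s None"
proof
  assume "converges_to s None"
  obtain y where y: "\<forall>\<^sub>F i in sequentially. s i = Some (y i)" "y \<longlonglongrightarrow> x"
    using assms by (auto simp: converges_to_def)
  define k where "k = min 0 (fls_subdegree x)"
  have x: "ord_ge k x" by (simp add: ord_ge_iff k_def)
  have "\<forall>\<^sub>F i in sequentially. ord_ge k (y i - x)" using y(2) by (simp add: tendsto_fls_iff)
  moreover have "\<forall>\<^sub>F i in sequentially. \<forall>z. s i = Some z \<longrightarrow> abs_inf z > real CARD('a) powi (- k)"
    using \<open>converges_to s None\<close> by (simp add: converges_to_def)
  ultimately have "\<forall>\<^sub>F i in sequentially. False" using y(1)
  proof eventually_elim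
    case (elim i)
    have "ord_ge k (y i - x + x)" using elim x by (intro ord_ge_add)
    then have "abs_inf (y i) \<le> real CARD('a) powi (- k)"
      by (intro abs_inf_le_if_ord_ge) simp
    then show ?case using elim by force
  qed
  then show False by simp
qed

lemma converges_to_unique:
  assumes "converges_to s L" "converges_to s L'"
  shows "L = L'"
proof (cases "L = None \<or> L' = None")
  case True
  then show ?thesis using assms converges_to_Some_not_None by (cases L; cases L') auto
next
  case False
  then obtain x x' where L: "L = Some x" "L' = Some x'" by auto
  obtain y y' where y: "\<forall>\<^sub>F i in sequentially. s i = Some (y i)" "y \<longlonglongrightarrow> x"
    "\<forall>\<^sub>F i in sequentially. s i = Some (y' i)" "y' \<longlonglongrightarrow> x'"
    using assms by (auto simp: converges_to_def L)
  have "\<forall>\<^sub>F i in sequentially. y i = y' i" using y(1,3) by eventually_elim simp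
  then have "y' \<longlonglongrightarrow> x" using y(2) by (rule Lim_transform_eventually[rotated])
  then show ?thesis using y(4) LIMSEQ_unique L by blast
qed

lemma converges_to_recip:
  fixes x :: "'a::{field,finite} fls"
  assumes y: "y \<longlonglongrightarrow> x"
  shows "converges_to (\<lambda>i. recip (y i)) (recip x)"
proof (cases "x = 0")
  case True
  have "\<forall>\<^sub>F i in sequentially. \<forall>z. recip (y i) = Some z \<longrightarrow> abs_inf z > B" for B
  proof -
    obtain n where n: "B < real CARD('a) ^ n"
      using real_arch_pow[OF card_gt_1_real] by blast
    have "\<forall>\<^sub>F i in sequentially. ord_ge (int n) (y i - x)" using y by (simp add: tendsto_fls_iff)
    then show ?thesis
    proof eventually_elim
      case (elim i)
      show ?case
      proof (intro allI impI)
        fix z assume "recip (y i) = Some z"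
        then have z: "inverse z = y i" "z \<noteq> 0" by (auto simp: recip_def divide_inverse split: if_splits)
        then show "abs_inf z > B"
          using abs_inf_ge_if_ord_ge_inverse[of "int n" z] elim n True by simp
      qed
    qed
  qed
  then show ?thesis by (simp add: converges_to_def recip_def True)
next
  case False
  have "\<forall>\<^sub>F i in sequentially. y i \<noteq> 0"
    using tendsto_imp_eventually_ne[OF y False] .
  then have "\<forall>\<^sub>F i in sequentially. recip (y i) = Some (1 / y i)"
    by eventually_elim (simp add: recip_def)
  moreover have "(\<lambda>i. 1 / y i) \<longlonglongrightarrow> 1 / x"
    using y False by (intro tendsto_divide_fls tendsto_const)
  ultimately show ?thesis
    unfolding converges_to_def recip_def[of x] using False by (auto intro!: exI[of _ "\<lambda>i. 1 / y i"])
qed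

section \<open>The set of limits\<close>

context quadratic_unit
begin

definition j_approx :: "int \<Rightarrow> 'a fls option" where
  "j_approx N = recip (1 / (T_inf ^ CARD('a) - T_inf) -
     (T_inf ^ (CARD('a)^2) - T_inf) / (T_inf ^ CARD('a) - T_inf) ^ (CARD('a) + 1) * J_approx N)"

lemma Lam_mon_eq:
  assumes "real CARD('a) powi (- N) < \<epsilon>" "\<epsilon> \<le> real CARD('a) powi (1 - N)"
  shows "Lam_mon \<epsilon> h = fst ` approx N"
proof -
  have Lam: "Lam_mon \<epsilon> h = {z. lead_coeff z = 1 \<and> (\<exists>w. ord_ge N (lat (z, w)))}"
    by (auto simp: Lam_mon_def Lam_def dist_A_less_iff abs_inf_less_iff[OF assms] lat_def)
  show ?thesis
  proof (intro equalityI subsetI)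
    fix z assume "z \<in> Lam_mon \<epsilon> h"
    then obtain w where "(z, w) \<in> approx N" by (auto simp: Lam approx_def)
    then show "z \<in> fst ` approx N" by (rule image_eqI[rotated]) simp
  qed (auto simp: Lam approx_def)
qed

lemma j_eps_eq:
  assumes "real CARD('a) powi (- N) < \<epsilon>" "\<epsilon> \<le> real CARD('a) powi (1 - N)" "N \<ge> N0"
  shows "j_eps \<epsilon> h = j_approx N"
proof -
  have "inj_on fst (approx N)" using assms(3) by (intro inj_on_fst_approx) (simp add: N0_def)
  then have "zeta_qt \<epsilon> h n = zeta_approx N n" for n
    unfolding zeta_qt_def zeta_approx_def Lam_mon_eq[OF assms(1,2)] by (simp add: infsum_reindex o_def)
  then show ?thesis by (simp add: j_eps_def J_eps_def J_tilde_def j_approx_def J_approx_def)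
qed

definition j_limit :: "int \<Rightarrow> 'a fls option" where
  "j_limit N = recip (1 / (T_inf ^ CARD('a) - T_inf) -
     (T_inf ^ (CARD('a)^2) - T_inf) / (T_inf ^ CARD('a) - T_inf) ^ (CARD('a) + 1) *
     (zeta_conj N (CARD('a)^2 - 1) / zeta_conj N (CARD('a) - 1) ^ (CARD('a) + 1)))"

lemma j_approx_converges_to:
  assumes "N \<ge> N0"
  shows "converges_to (\<lambda>l. j_approx (N + int l * fls_subdegree \<eta>)) (j_limit N)"
  unfolding j_approx_def j_limit_def
  by (intro converges_to_recip tendsto_diff tendsto_mult tendsto_const J_approx_tendsto assms)

text \<open>
  Along any \<open>\<epsilon>\<^sub>i \<rightarrow> 0\<close> the scales tend to infinity, and infinitely many of them lie in one
  residue class modulo \<open>m\<close>. On this subsequence \<open>j\<close> converges to the limit of that class.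
\<close>

lemma j_qt_subset: "j_qt h \<subseteq> j_limit ` {N0..<N0 + fls_subdegree \<eta>}"
proof
  fix L assume "L \<in> j_qt h"
  then obtain \<epsilon> where \<epsilon>: "\<And>i. \<epsilon> i > 0" "\<epsilon> \<longlonglongrightarrow> 0" "converges_to (\<lambda>i. j_eps (\<epsilon> i) h) L"
    by (auto simp: j_qt_def)
  define q where "q = real CARD('a)"
  have q: "q > 1" unfolding q_def by (rule card_gt_1_real)
  have "\<exists>N. q powi (- N) < \<epsilon> i \<and> \<epsilon> i \<le> q powi (1 - N)" for i
    using ex_scale[OF q \<epsilon>(1)] by metis
  then obtain N where N: "q powi (- N i) < \<epsilon> i" "\<epsilon> i \<le> q powi (1 - N i)" for i
    by metis
  have N_large: "\<forall>\<^sub>F i in sequentially. N i \<ge> M" for M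
  proof -
    have "q powi (- M) > 0" using q by simp
    then have "\<forall>\<^sub>F i in sequentially. \<epsilon> i < q powi (- M)" using \<epsilon>(2) by (rule order_tendstoD[rotated])
    then show ?thesis
    proof eventually_elim
      case (elim i)
      show ?case
      proof (rule ccontr)
        assume "\<not> N i \<ge> M"
        then have "q powi (- M) \<le> q powi (- N i)" using q by (intro power_int_increasing) auto
        then show False using elim N(1)[of i] by simp
      qed
    qed
  qed
  define m where "m = fls_subdegree \<eta>"
  have m: "m > 0" unfolding m_def by (rule subdegree_eta)
  define I where "I = {i. N i \<ge> N0}"
  have "infinite I"
  proof -
    from N_large[of N0] obtain k where "\<forall>i\<ge>k. N i \<ge> N0" by (auto simp: eventually_sequentially)
    then have "{k..} \<subseteq> I" by (auto simp: I_def)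
    then show ?thesis using infinite_Ici finite_subset by blast
  qed
  moreover have "(\<lambda>i. (N i - N0) mod m) ` I \<subseteq> {0..<m}" using m by auto
  then have "finite ((\<lambda>i. (N i - N0) mod m) ` I)" by (rule finite_subset) simp
  ultimately obtain i0 where "infinite {i \<in> I. (N i - N0) mod m = (N i0 - N0) mod m}"
    using pigeonhole_infinite by blast
  then obtain K r where K: "infinite K" "K \<subseteq> I" "\<And>i. i \<in> K \<Longrightarrow> (N i - N0) mod m = r"
    and r: "r = (N i0 - N0) mod m" by auto
  have r: "0 \<le> r" "r < m" using m r by auto
  define \<phi> where "\<phi> = enumerate K"
  have \<phi>: "\<phi> k \<in> K" "filterlim \<phi> sequentially sequentially" for k
    using K(1) by (auto simp: \<phi>_def enumerate_in_set intro!: filterlim_subseq strict_mono_enumerate)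
  define l where "l k = nat ((N (\<phi> k) - N0) div m)" for k
  have Nl: "N (\<phi> k) = N0 + r + int (l k) * m" for k
  proof -
    have "N (\<phi> k) \<ge> N0" using \<phi>(1)[of k] K(2) by (auto simp: I_def)
    then have "int (l k) = (N (\<phi> k) - N0) div m" using m by (simp add: l_def pos_imp_zdiv_nonneg_iff)
    then show ?thesis using K(3)[OF \<phi>(1)[of k]] div_mult_mod_eq[of "N (\<phi> k) - N0" m] by simp
  qed
  have l: "filterlim l sequentially sequentially"
    unfolding filterlim_at_top
  proof
    fix Z
    have "\<forall>\<^sub>F k in sequentially. N (\<phi> k) \<ge> N0 + r + int Z * m"
      using N_large \<phi>(2) by (rule eventually_compose_filterlim)
    then show "\<forall>\<^sub>F k in sequentially. Z \<le> l k"
      by eventually_elim (use m in \<open>simp add: Nl\<close>)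
  qed
  have "converges_to (\<lambda>k. j_eps (\<epsilon> (\<phi> k)) h) L"
    using \<epsilon>(3) \<phi>(2) by (rule converges_to_compose)
  moreover have "j_eps (\<epsilon> (\<phi> k)) h = j_approx (N0 + r + int (l k) * m)" for k
    unfolding Nl[symmetric] using N[of "\<phi> k"] \<phi>(1)[of k] K(2)
    by (intro j_eps_eq) (auto simp: q_def I_def)
  moreover have "converges_to (\<lambda>k. j_approx (N0 + r + int (l k) * m)) (j_limit (N0 + r))"
    unfolding m_def using r(1)
    by (intro converges_to_compose[OF j_approx_converges_to l]) simp
  ultimately have "L = j_limit (N0 + r)" using converges_to_unique by simp
  then show "L \<in> j_limit ` {N0..<N0 + fls_subdegree \<eta>}"
    using r by (auto simp: m_def)
qed

end

lemma ratfuns_common_denominator: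
  fixes x0 x1 x2 :: "'a::{field,finite} fls"
  assumes "x0 \<in> ratfuns" "x1 \<in> ratfuns" "x2 \<in> ratfuns"
  obtains d y0 y1 y2 where "d \<noteq> 0" "A_to_kinf d * x0 = A_to_kinf y0"
    "A_to_kinf d * x1 = A_to_kinf y1" "A_to_kinf d * x2 = A_to_kinf y2"
proof -
  obtain a0 b0 a1 b1 a2 b2 where x: "x0 = A_to_kinf a0 / A_to_kinf b0" "b0 \<noteq> 0"
    "x1 = A_to_kinf a1 / A_to_kinf b1" "b1 \<noteq> 0" "x2 = A_to_kinf a2 / A_to_kinf b2" "b2 \<noteq> 0"
    using assms by (auto simp: ratfuns_def)
  show thesis
    by (rule that[of "b0 * b1 * b2" "a0 * b1 * b2" "a1 * b0 * b2" "a2 * b0 * b1"])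
       (use x in \<open>simp_all add: A_to_kinf_mult field_simps\<close>)
qed

lemma quadratic_integral_equation:
  fixes h :: "'a::{field,finite} fls"
  assumes "quadratic_over ratfuns h"
  obtains a b c where "a \<noteq> 0" "A_to_kinf a * h ^ 2 + A_to_kinf b * h + A_to_kinf c = 0"
proof -
  obtain P where P: "degree P = 2" "\<And>i. coeff P i \<in> ratfuns" "poly P h = 0"
    using assms by (auto simp: quadratic_over_def)
  obtain d c b a where d: "d \<noteq> 0" "A_to_kinf d * coeff P 0 = A_to_kinf c"
    "A_to_kinf d * coeff P 1 = A_to_kinf b" "A_to_kinf d * coeff P 2 = A_to_kinf a"
    using ratfuns_common_denominator[OF P(2) P(2) P(2)] by metis
  have "coeff P 2 \<noteq> 0" using P(1) by (metis degree_0 leading_coeff_0_iff zero_neq_numeral)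
  then have "A_to_kinf a \<noteq> 0" using d(1) unfolding d(4)[symmetric] by simp
  then have "a \<noteq> 0" by simp
  have "poly P h = coeff P 0 + coeff P 1 * h + coeff P 2 * h ^ 2"
    using P(1) by (simp add: poly_altdef numeral_2_eq_2 algebra_simps)
  then have "A_to_kinf d * (coeff P 0 + coeff P 1 * h + coeff P 2 * h ^ 2) = 0" using P(3) by simp
  then have "A_to_kinf a * h ^ 2 + A_to_kinf b * h + A_to_kinf c = 0"
    unfolding d(2-4)[symmetric] by (simp add: algebra_simps)
  with \<open>a \<noteq> 0\<close> show thesis by (rule that)
qed

theorem theorem2:
  fixes h :: "'a::{field,finite} fls"
  assumes "h \<notin> ratfuns" and "quadratic_over ratfuns h"
  shows "finite (j_qt h)"
proof -
  obtain a b c where a: "a \<noteq> 0" and root: "A_to_kinf a * h ^ 2 + A_to_kinf b * h + A_to_kinf c = 0"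
    using assms(2) by (rule quadratic_integral_equation)
  define \<omega> where "\<omega> = A_to_kinf a * h"
  have "\<omega> \<notin> ratfuns"
  proof
    assume "\<omega> \<in> ratfuns"
    then obtain x y where "\<omega> = A_to_kinf x / A_to_kinf y" "y \<noteq> 0" by (auto simp: ratfuns_def)
    then have "h = A_to_kinf x / A_to_kinf (a * y)" "a * y \<noteq> 0"
      using a by (auto simp: \<omega>_def A_to_kinf_mult field_simps)
    then show False using assms(1) unfolding ratfuns_def by blast
  qed
  moreover have "\<omega> ^ 2 = A_to_kinf (- b) * \<omega> - A_to_kinf (a * c)"
  proof -
    have "\<omega> ^ 2 = A_to_kinf a * (A_to_kinf a * h ^ 2 + A_to_kinf b * h + A_to_kinf c)
        - A_to_kinf b * \<omega> - A_to_kinf a * A_to_kinf c"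
      by (simp add: \<omega>_def power2_eq_square algebra_simps)
    then show ?thesis by (simp add: root A_to_kinf_hom)
  qed
  ultimately obtain u v where uv: "u ^ 2 + u * v * (- b) + v ^ 2 * (a * c) = 1"
    "fls_subdegree (A_to_kinf u + A_to_kinf v * \<omega>) > 0"
    "lead (A_to_kinf u + A_to_kinf v * (A_to_kinf (- b) - \<omega>)) = 1"
    using pell_unit by metis
  interpret quadratic_unit h a b c u v
    by unfold_locales (use assms(1) a root uv in \<open>simp_all add: \<omega>_def A_to_kinf_minus mult.assoc\<close>)
  show ?thesis by (rule finite_subset[OF j_qt_subset]) simp
qed

end
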